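(* For every $\delta>0$ there is $\widetilde V=\widetilde V(\delta)>0$ such that for every $0<V<\widetilde V$, $$(1-\delta)V\le F_\ell(V)\le V.$$ In particular, $$\lim_{V\to0}\frac{1}{V}F_\ell(V)=1.$$
   Context: For $h:\mathbb{R}\to[0,\infty)$ lower semicontinuous, let $\Omega_h:=\{(x,y)\in\mathbb{R}^2:0<y<h(x)\}$ and let $\int_{\mathbb{R}}|h'|$ denote the pointwise variation $\sup\{\sum_{i}|h(x_i)-h(x_{i-1})|: x_1<\dots<x_n\}$. For $V>0$, let $\mathcal{A}^\ell_V$ be the set of pairs $(u,h)$ with $h\in BV(\mathbb{R})$ lower semicontinuous, $h\ge0$, $u\in H^1(\Omega_h)$ real-valued, $\int_{\mathbb{R}}h\,dx=V$, and $u(x,0)=x$ (in the sense of traces) for $x\in\operatorname{supp}h$. Set $$F_\ell(V):=\inf\left\{\int_{\Omega_h}|\nabla u|^2\,dx\,dy+\int_{\mathbb{R}}|h'| : (u,h)\in\mathcal{A}^\ell_V\right\}.$$ *)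

theory Defs
  imports "HOL-Analysis.Analysis"
begin

definition tsupp :: "('a::topological_space \<Rightarrow> 'b::zero) \<Rightarrow> 'a set" where
  "tsupp f = closure {x. f x \<noteq> 0}"

definition lower_semicont :: "(real \<Rightarrow> real) \<Rightarrow> bool" where
  "lower_semicont h \<longleftrightarrow> (\<forall>x. \<forall>c < h x. \<forall>\<^sub>F y in nhds x. c < h y)"

definition C1_fun :: "('a::euclidean_space \<Rightarrow> real) \<Rightarrow> ('a \<Rightarrow> 'a) \<Rightarrow> bool" where
  "C1_fun \<phi> D\<phi> \<longleftrightarrow> (\<forall>x. GDERIV \<phi> x :> D\<phi> x) \<and> continuous_on UNIV D\<phi>"

definition test_fun :: "'a::euclidean_space set \<Rightarrow> ('a \<Rightarrow> real) \<Rightarrow> ('a \<Rightarrow> 'a) \<Rightarrow> bool" where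
  "test_fun \<Omega> \<phi> D\<phi> \<longleftrightarrow> C1_fun \<phi> D\<phi> \<and> compact (tsupp \<phi>) \<and> tsupp \<phi> \<subseteq> \<Omega>"

definition L2 :: "'a::euclidean_space set \<Rightarrow> ('a \<Rightarrow> 'b::euclidean_space) \<Rightarrow> bool" where
  "L2 \<Omega> f \<longleftrightarrow> f \<in> borel_measurable (lebesgue_on \<Omega>) \<and>
     integrable (lebesgue_on \<Omega>) (\<lambda>x. (norm (f x))\<^sup>2)"

text \<open>Weak gradients are tested against compactly supported functions of class C1; by
  mollification this gives the same notion as smooth test functions. Both integrals are
  vector valued, so the identity comprises all partial derivatives at once.\<close>

definition has_weak_gradient ::
  "'a::euclidean_space set \<Rightarrow> ('a \<Rightarrow> real) \<Rightarrow> ('a \<Rightarrow> 'a) \<Rightarrow> bool" where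
  "has_weak_gradient \<Omega> u g \<longleftrightarrow> L2 \<Omega> g \<and>
     (\<forall>\<phi> D\<phi>. test_fun \<Omega> \<phi> D\<phi> \<longrightarrow>
        (LINT x|lebesgue_on \<Omega>. u x *\<^sub>R D\<phi> x) = - (LINT x|lebesgue_on \<Omega>. \<phi> x *\<^sub>R g x))"

definition H1 :: "'a::euclidean_space set \<Rightarrow> ('a \<Rightarrow> real) set" where
  "H1 \<Omega> = {u. L2 \<Omega> u \<and> (\<exists>g. has_weak_gradient \<Omega> u g)}"

text \<open>On an open set the weak gradient is determined up to null sets, and it is used below
  only under integrals.\<close>

definition weak_grad :: "'a::euclidean_space set \<Rightarrow> ('a \<Rightarrow> real) \<Rightarrow> 'a \<Rightarrow> 'a" where
  "weak_grad \<Omega> u = (SOME g. has_weak_gradient \<Omega> u g)"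

definition dirichlet :: "'a::euclidean_space set \<Rightarrow> ('a \<Rightarrow> real) \<Rightarrow> real" where
  "dirichlet \<Omega> u = (LINT x|lebesgue_on \<Omega>. (norm (weak_grad \<Omega> u x))\<^sup>2)"

text \<open>Membership in \<open>BV(\<real>)\<close>: \<open>h\<close> is integrable and its distributional derivative is a finite
  measure.\<close>

definition BV :: "(real \<Rightarrow> real) set" where
  "BV = {h. integrable lebesgue h \<and>
     (\<exists>C. \<forall>\<phi> D\<phi>. test_fun UNIV \<phi> D\<phi> \<and> (\<forall>x. \<bar>\<phi> x\<bar> \<le> 1) \<longrightarrow>
        (LINT x|lebesgue. h x * D\<phi> x) \<le> C)}"

definition pointwise_variation :: "(real \<Rightarrow> real) \<Rightarrow> ereal" where
  "pointwise_variation h =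
     (SUP xs \<in> {xs. sorted_wrt (<) xs}.
        ereal (\<Sum>i = 1..<length xs. \<bar>h (xs ! i) - h (xs ! (i - 1))\<bar>))"

definition subgraph :: "(real \<Rightarrow> real) \<Rightarrow> (real \<times> real) set" where
  "subgraph h = {(x, y). 0 < y \<and> y < h x}"

text \<open>\<open>T\<close> is the trace of \<open>u\<close>, a function in H1 of the rectangle \<open>R\<close>, on the lower side of \<open>R\<close>:
  the continuous extension of the restriction map from functions of class C1 up to the boundary.\<close>

definition bottom_trace ::
  "real \<Rightarrow> real \<Rightarrow> real \<Rightarrow> (real \<times> real \<Rightarrow> real) \<Rightarrow> (real \<Rightarrow> real) \<Rightarrow> bool" where
  "bottom_trace a b c u T \<longleftrightarrow>
     (let R = {a<..<b} \<times> {0<..<c} in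
      L2 {a<..<b} T \<and>
      (\<exists>v Dv. (\<forall>n::nat. C1_fun (v n) (Dv n)) \<and>
        (\<lambda>n. LINT p|lebesgue_on R.
           (v n p - u p)\<^sup>2 + (norm (Dv n p - weak_grad R u p))\<^sup>2) \<longlonglongrightarrow> 0 \<and>
        (\<lambda>n. LINT x|lebesgue_on {a<..<b}. (v n (x, 0) - T x)\<^sup>2) \<longlonglongrightarrow> 0))"

text \<open>\<open>u(x,0) = g x\<close> for \<open>x \<in> S\<close> in the sense of traces. The upper boundary of the subgraph
  may be irregular, but for lower semicontinuous \<open>h\<close> every point of the open set \<open>{h > 0}\<close> lies
  in the base of some rectangle contained in the subgraph, so the trace is taken
  locally on such rectangles. Points with \<open>h x = 0\<close> have no film above them and
  carry no trace.\<close>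

definition trace_eq_on ::
  "(real \<Rightarrow> real) \<Rightarrow> (real \<times> real \<Rightarrow> real) \<Rightarrow> (real \<Rightarrow> real) \<Rightarrow> real set \<Rightarrow> bool" where
  "trace_eq_on h u g S \<longleftrightarrow>
     (\<forall>a b c. a < b \<and> 0 < c \<and> {a<..<b} \<times> {0<..<c} \<subseteq> subgraph h \<longrightarrow>
        (\<exists>T. bottom_trace a b c u T \<and> (AE x in lebesgue_on {a<..<b}. x \<in> S \<longrightarrow> T x = g x)))"

definition admissible :: "real \<Rightarrow> ((real \<times> real \<Rightarrow> real) \<times> (real \<Rightarrow> real)) set" where
  "admissible V = {(u, h). h \<in> BV \<and> lower_semicont h \<and> (\<forall>x. 0 \<le> h x) \<and>
     u \<in> H1 (subgraph h) \<and> (LINT x|lebesgue. h x) = V \<and>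
     trace_eq_on h u (\<lambda>x. x) (tsupp h)}"

definition F_ell :: "real \<Rightarrow> ereal" where
  "F_ell V = (INF (u, h) \<in> admissible V.
     ereal (dirichlet (subgraph h) u) + pointwise_variation h)"

end

theory Submission
  imports Defs
begin

text \<open>The upper bound comes from long flat films: a film of height \<open>e\<close> over an interval of length
\<open>V / e\<close> with the displacement \<open>u(x,y) = x\<close> has Dirichlet energy \<open>V\<close> and variation \<open>2 e\<close>, and
\<open>e\<close> is arbitrarily small (\<open>F_ell_upper_bound\<close>).

The lower bound is a duality argument. Let \<open>(u,h)\<close> be admissible with weak gradient \<open>g\<close>, and let
\<open>W\<close> be the variation of \<open>h\<close>. For every vector field \<open>\<sigma>\<close>, pointwise
\<open>|g|\<^sup>2 \<ge> 2 g \<bullet> \<sigma> - |\<sigma>|\<^sup>2\<close>. Suppose that \<open>\<sigma>\<close> is divergence free and vanishes near the free boundary of the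
film. The only boundary values that enter \<open>\<integral> g \<bullet> \<sigma>\<close> are then those at the bottom, where \<open>u\<close> agrees
with \<open>(x,y) \<mapsto> x\<close>; so \<open>\<integral> g \<bullet> \<sigma>\<close> is the integral of the first component of \<open>\<sigma>\<close>
(\<open>extends_boundary_test\<close>). No trace of \<open>u\<close> on the irregular upper boundary is involved.

A suitable field is the rotated gradient of a smoothed positive part of \<open>f(x) - y\<close>. Up to
smoothing it is \<open>(1, f'(x))\<close> below the graph of \<open>f\<close> and zero above. Here \<open>f\<close> is a smooth profile
below \<open>h\<close> with \<open>|f'| \<le> \<epsilon>\<close> whose positive part has compact support; up to an arbitrarily small error
the energy is then at least \<open>(1 - \<epsilon>\<^sup>2) \<integral> f\<close>
(\<open>energy_ge_smooth_profile\<close>). The best profile is the infimal convolution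
\<open>inf\<^sub>z h(z) + \<epsilon> |x - z|\<close>, the largest \<open>\<epsilon>\<close>-Lipschitz function below \<open>h\<close>. Its value at \<open>x\<close> depends only on
\<open>h\<close> at distance at most \<open>W / \<epsilon>\<close> from \<open>x\<close>, because \<open>h\<close> oscillates by at most \<open>W\<close>. Hence the area lost
in passing from \<open>h\<close> to the profile is at most \<open>2 W\<^sup>2 / \<epsilon>\<close>: at each point the loss is bounded
by the variation of \<open>h\<close> on an interval of length \<open>2 W / \<epsilon>\<close>, and integrating this bound in \<open>x\<close> counts
each piece of variation over a length of at most \<open>2 W / \<epsilon>\<close>. If \<open>W \<ge> V\<close> the lower
bound is trivial; otherwise \<open>V < \<epsilon> / 2\<close> makes this loss at most \<open>W\<close>, and it is paid for by the
variation term of the functional (\<open>F_ell_lower_bound\<close>).\<close>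

section \<open>Smooth cut-offs and functions of class C1\<close>

text \<open>The two squares vanish to second order at \<open>0\<close> and at \<open>1\<close> and never simultaneously, so the quotient
  is a transition from \<open>0\<close> to \<open>1\<close> of class C1; products with it localise test functions.\<close>

definition smooth_step :: "real \<Rightarrow> real" where
  "smooth_step s = (max 0 s)\<^sup>2 / ((max 0 s)\<^sup>2 + (max 0 (1 - s))\<^sup>2)"

lemma has_real_derivative_max_square:
  "((\<lambda>s. (max 0 s)\<^sup>2) has_real_derivative 2 * max 0 s) (at (s::real))"
proof -
  consider "s < 0" | "s = 0" | "s > 0" by linarith
  then show ?thesis
  proof cases
    case 1
    have "((\<lambda>s. 0) has_real_derivative 2 * max 0 s) (at s)" using 1 by simp
    then show ?thesis
      by (rule has_field_derivative_transform_within_open[where S = "{..<0}"]) (use 1 in auto)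
  next
    case 3
    have "((\<lambda>s. s\<^sup>2) has_real_derivative 2 * max 0 s) (at s)"
      using 3 by (auto intro!: derivative_eq_intros)
    then show ?thesis
      by (rule has_field_derivative_transform_within_open[where S = "{0<..}"]) (use 3 in auto)
  next
    case 2
    have "(\<lambda>h::real. (max 0 h)\<^sup>2 / h) \<midarrow>0\<rightarrow> 0"
    proof (rule Lim_null_comparison)
      show "\<forall>\<^sub>F h in at 0. norm ((max 0 h)\<^sup>2 / h) \<le> \<bar>h::real\<bar>"
        by (rule always_eventually) (auto simp: max_def power2_eq_square)
      show "((\<lambda>h. \<bar>h::real\<bar>) \<longlongrightarrow> 0) (at 0)"
        by (auto intro!: tendsto_eq_intros)
    qed
    then show ?thesis using 2 by (simp add: has_field_derivative_iff)
  qed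
qed

lemma smooth_step_denominator: "(max 0 s)\<^sup>2 + (max 0 (1 - s))\<^sup>2 > (0::real)"
proof (cases "s > 0")
  case True then show ?thesis by (auto intro!: add_pos_nonneg)
next
  case False then show ?thesis by (auto intro!: add_nonneg_pos)
qed

lemma smooth_step_range: "0 \<le> smooth_step s" "smooth_step s \<le> 1"
  using smooth_step_denominator[of s] by (auto simp: smooth_step_def)

lemma smooth_step_eq_0: "s \<le> 0 \<Longrightarrow> smooth_step s = 0"
  by (simp add: smooth_step_def)

lemma smooth_step_eq_1: "s \<ge> 1 \<Longrightarrow> smooth_step s = 1"
  by (simp add: smooth_step_def)

lemma smooth_step_C1:
  obtains d where "\<And>s. (smooth_step has_real_derivative d s) (at s)" "continuous_on UNIV d"
proof -
  let ?p = "\<lambda>s::real. (max 0 s)\<^sup>2"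
  let ?D = "\<lambda>s::real. ?p s + ?p (1 - s)"
  define d where "d s = (2 * max 0 s * ?D s - ?p s * (2 * max 0 s - 2 * max 0 (1 - s))) / (?D s * ?D s)"
    for s :: real
  have q: "((\<lambda>s. ?p (1 - s)) has_real_derivative - (2 * max 0 (1 - s))) (at s)" for s :: real
  proof -
    have "((\<lambda>s. 1 - s) has_real_derivative -1) (at s)" by (auto intro!: derivative_eq_intros)
    from DERIV_chain2[OF has_real_derivative_max_square this] show ?thesis by simp
  qed
  have nz: "?D s \<noteq> 0" for s using smooth_step_denominator[of s] by linarith
  have "((\<lambda>s. ?p s / ?D s) has_real_derivative d s) (at s)" for s
  proof -
    have "(?D has_real_derivative (2 * max 0 s + - (2 * max 0 (1 - s)))) (at s)"
      by (rule DERIV_add[OF has_real_derivative_max_square q])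
    from DERIV_divide[OF has_real_derivative_max_square this nz] show ?thesis
      unfolding d_def by (simp only: diff_conv_add_uminus)
  qed
  moreover have "smooth_step = (\<lambda>s. ?p s / ?D s)" by (auto simp: smooth_step_def)
  moreover have "continuous_on UNIV d"
    unfolding d_def using nz by (intro continuous_intros) auto
  ultimately show ?thesis using that by metis
qed

lemma C1_fun_continuous: "C1_fun f F \<Longrightarrow> continuous_on S f"
  unfolding C1_fun_def gderiv_def
  by (meson continuous_on_subset differentiableI differentiable_at_imp_differentiable_on
      differentiable_imp_continuous_on)

lemma C1_fun_mult:
  assumes "C1_fun f F" "C1_fun g G"
  shows "C1_fun (\<lambda>p. f p * g p) (\<lambda>p. f p *\<^sub>R G p + g p *\<^sub>R F p)"
proof -
  have "continuous_on UNIV f" "continuous_on UNIV g"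
    using assms by (auto intro: C1_fun_continuous)
  then show ?thesis
    using assms unfolding C1_fun_def by (auto intro!: GDERIV_mult continuous_intros)
qed

lemma C1_fun_grad_continuous: "C1_fun f F \<Longrightarrow> continuous_on S F"
  unfolding C1_fun_def using continuous_on_subset by blast

lemma C1_fun_compose:
  assumes "C1_fun f F" "\<And>s. (t has_real_derivative t' s) (at s)" "continuous_on UNIV t'"
  shows "C1_fun (\<lambda>p. t (f p)) (\<lambda>p. t' (f p) *\<^sub>R F p)"
proof -
  have "continuous_on UNIV (\<lambda>p. t' (f p))"
    using continuous_on_compose2[OF assms(3) C1_fun_continuous[OF assms(1)]] by auto
  then show ?thesis
    using assms(1) GDERIV_DERIV_compose[OF _ assms(2)] unfolding C1_fun_def
    by (auto intro!: continuous_intros)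
qed

lemma C1_fun_fst: "C1_fun (fst :: real \<times> real \<Rightarrow> real) (\<lambda>p. (1, 0))"
  unfolding C1_fun_def gderiv_def by (auto intro!: derivative_eq_intros)

lemma C1_fun_snd: "C1_fun (snd :: real \<times> real \<Rightarrow> real) (\<lambda>p. (0, 1))"
  unfolding C1_fun_def gderiv_def by (auto intro!: derivative_eq_intros)

text \<open>Supports of test functions are described by values only; this transfers them to the gradients.\<close>

lemma C1_fun_eq_0_imp_grad_0:
  assumes "C1_fun f F" "open U" "\<And>p. p \<in> U \<Longrightarrow> f p = 0" "p \<in> U"
  shows "F p = 0"
proof -
  have "(f has_derivative (\<lambda>h. h \<bullet> F p)) (at p)" using assms(1) by (simp add: C1_fun_def gderiv_def)
  moreover have "(f has_derivative (\<lambda>h. 0)) (at p)"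
    by (rule has_derivative_transform_within_open[OF has_derivative_const assms(2) assms(4)])
       (use assms(3) in auto)
  ultimately have "(\<lambda>h. h \<bullet> F p) = (\<lambda>h. 0)" by (rule has_derivative_unique)
  then have "F p \<bullet> F p = 0" by metis
  then show ?thesis by simp
qed

lemma C1_fun_step:
  assumes "C1_fun f F"
  obtains G where "C1_fun (\<lambda>p. smooth_step (\<alpha> * f p + \<beta>)) G"
proof -
  obtain d where d: "\<And>s. (smooth_step has_real_derivative d s) (at s)" "continuous_on UNIV d"
    using smooth_step_C1 by blast
  have "((\<lambda>s. smooth_step (\<alpha> * s + \<beta>)) has_real_derivative d (\<alpha> * s + \<beta>) * \<alpha>) (at s)" for s
  proof -
    have "((\<lambda>s. \<alpha> * s + \<beta>) has_real_derivative \<alpha>) (at s)" by (auto intro!: derivative_eq_intros)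
    from DERIV_chain2[OF d(1) this] show ?thesis .
  qed
  moreover have "continuous_on UNIV (\<lambda>s. d (\<alpha> * s + \<beta>) * \<alpha>)"
    by (intro continuous_intros continuous_on_compose2[OF d(2)]) auto
  ultimately show ?thesis
    using that C1_fun_compose[OF assms, where t = "\<lambda>s. smooth_step (\<alpha> * s + \<beta>)"
        and t' = "\<lambda>s. d (\<alpha> * s + \<beta>) * \<alpha>"] by simp
qed

lemma C1_fun_diff: "C1_fun f F \<Longrightarrow> C1_fun g G \<Longrightarrow> C1_fun (\<lambda>p. f p - g p) (\<lambda>p. F p - G p)"
  unfolding C1_fun_def by (auto intro!: GDERIV_diff continuous_intros)

section \<open>Local integrability\<close>

lemma lebesgue_integral_on_subset:
  fixes F :: "'a::euclidean_space \<Rightarrow> 'b::{banach, second_countable_topology}"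
  assumes "R \<subseteq> \<Omega>" "R \<in> sets lebesgue" "\<Omega> \<in> sets lebesgue" "\<And>p. p \<in> \<Omega> - R \<Longrightarrow> F p = 0"
  shows "(LINT p|lebesgue_on \<Omega>. F p) = (LINT p|lebesgue_on R. F p)"
proof -
  have "(\<lambda>p. indicat_real \<Omega> p *\<^sub>R F p) = (\<lambda>p. indicat_real R p *\<^sub>R F p)"
    using assms(1,4) by (auto simp: indicator_def fun_eq_iff)
  then show ?thesis using assms by (simp add: integral_restrict_space)
qed

lemma integrable_lebesgue_on_subset:
  fixes F :: "'a::euclidean_space \<Rightarrow> 'b::{banach, second_countable_topology}"
  assumes "integrable (lebesgue_on \<Omega>) F" "R \<subseteq> \<Omega>" "R \<in> sets lebesgue" "\<Omega> \<in> sets lebesgue"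
  shows "integrable (lebesgue_on R) F"
proof -
  have "integrable lebesgue (\<lambda>p. indicat_real \<Omega> p *\<^sub>R F p)"
    using assms by (simp add: integrable_restrict_space)
  then have "integrable lebesgue (\<lambda>p. indicat_real R p *\<^sub>R indicat_real \<Omega> p *\<^sub>R F p)"
    by (rule integrable_mult_indicator[OF assms(3)])
  moreover have "(\<lambda>p. indicat_real R p *\<^sub>R indicat_real \<Omega> p *\<^sub>R F p) = (\<lambda>p. indicat_real R p *\<^sub>R F p)"
    using assms(2) by (auto simp: indicator_def fun_eq_iff)
  ultimately show ?thesis using assms by (simp add: integrable_restrict_space)
qed

lemma L2_subset:
  assumes "L2 \<Omega> f" "R \<subseteq> \<Omega>" "R \<in> sets lebesgue" "\<Omega> \<in> sets lebesgue"
  shows "L2 R f"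
  using assms unfolding L2_def
  by (meson measurable_restrict_mono integrable_lebesgue_on_subset)

text \<open>The domain may have infinite measure, so square integrability yields integrability only on a
  compact set, through \<open>t \<le> 1 + t\<^sup>2\<close>.\<close>

lemma L2_imp_integrable_local:
  fixes F :: "'a::euclidean_space \<Rightarrow> 'c::euclidean_space"
  assumes "\<Omega> \<in> sets lebesgue" "L2 \<Omega> f" "F \<in> borel_measurable (lebesgue_on \<Omega>)" "compact K"
    and "\<And>p. p \<in> \<Omega> \<Longrightarrow> p \<in> K \<Longrightarrow> norm (F p) \<le> C * norm (f p)" "\<And>p. p \<in> \<Omega> \<Longrightarrow> p \<notin> K \<Longrightarrow> F p = 0"
  shows "integrable (lebesgue_on \<Omega>) F"
proof (rule Bochner_Integration.integrable_bound[OF _ assms(3)])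
  have K: "K \<in> lmeasurable" using assms(4) by (simp add: lmeasurable_compact)
  have "integrable (lebesgue_on \<Omega>) (\<lambda>p. indicat_real K p)"
  proof (subst integrable_restrict_space)
    have "\<Omega> \<inter> K \<in> lmeasurable" using fmeasurable_Int_fmeasurable[OF K assms(1)] by (simp add: Int_commute)
    then show "integrable lebesgue (\<lambda>p. indicat_real \<Omega> p *\<^sub>R indicat_real K p)"
      unfolding lmeasurable_iff_integrable
      by (rule back_subst[where P = "integrable lebesgue"]) (auto simp: indicator_def fun_eq_iff)
  qed (use assms(1) in auto)
  then show "integrable (lebesgue_on \<Omega>) (\<lambda>p. \<bar>C\<bar> * (indicat_real K p + (norm (f p))\<^sup>2))"
    using assms(2) by (auto simp: L2_def)
  have "norm (F p) \<le> norm (\<bar>C\<bar> * (indicat_real K p + (norm (f p))\<^sup>2))" if "p \<in> \<Omega>" for p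
  proof (cases "p \<in> K")
    case True
    have "norm (f p) \<le> 1 + (norm (f p))\<^sup>2"
      using sum_squares_ge_zero[of "norm (f p) - 1" 0] by (simp add: power2_eq_square algebra_simps) 
        (smt (verit) mult_nonneg_nonneg norm_ge_zero)
    then have "\<bar>C\<bar> * norm (f p) \<le> \<bar>C\<bar> * (1 + (norm (f p))\<^sup>2)" by (intro mult_left_mono) auto
    moreover have "C * norm (f p) \<le> \<bar>C\<bar> * norm (f p)" by (intro mult_right_mono) auto
    ultimately show ?thesis using assms(5)[OF that True] True by (auto simp: abs_mult)
  qed (use assms(6)[OF that] in auto)
  then show "AE p in lebesgue_on \<Omega>. norm (F p) \<le> norm (\<bar>C\<bar> * (indicat_real K p + (norm (f p))\<^sup>2))"
    using assms(1) by (auto intro!: AE_I2)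
qed

lemma borel_measurable_continuous_lebesgue_on:
  "continuous_on UNIV f \<Longrightarrow> \<Omega> \<in> sets lebesgue \<Longrightarrow> f \<in> borel_measurable (lebesgue_on \<Omega>)"
  using continuous_imp_measurable_on_sets_lebesgue continuous_on_subset by blast

lemma box_eq_rectangle: "box (a::real, c) (b, d::real) = {a<..<b} \<times> {c<..<d}"
  by (auto simp: box_def Basis_prod_def)

lemma mem_box_prod_real:
  "p \<in> box (a::real, c) (b, d::real) \<longleftrightarrow> a < fst p \<and> fst p < b \<and> c < snd p \<and> snd p < d"
  by (cases p) (auto simp: box_eq_rectangle)

lemma mem_cbox_prod_real:
  "p \<in> cbox (a::real, c) (b, d::real) \<longleftrightarrow> a \<le> fst p \<and> fst p \<le> b \<and> c \<le> snd p \<and> snd p \<le> d"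
  by (cases p) (auto simp: cbox_Pair_eq)

lemma continuous_bounded_on_compact:
  fixes \<phi> :: "'a::metric_space \<Rightarrow> 'b::real_normed_vector"
  assumes "continuous_on UNIV \<phi>" "compact K"
  obtains C where "\<And>p. p \<in> K \<Longrightarrow> norm (\<phi> p) \<le> C"
proof -
  have "bounded (\<phi> ` K)"
    using assms by (auto intro!: compact_imp_bounded compact_continuous_image intro: continuous_on_subset)
  then obtain C where "\<forall>x\<in>\<phi> ` K. norm x \<le> C" unfolding bounded_iff by blast
  then show ?thesis using that by blast
qed

lemma integrable_continuous_scaleR_L2:
  fixes \<phi> :: "'a::euclidean_space \<Rightarrow> real" and f :: "'a \<Rightarrow> 'b::euclidean_space"
  assumes "\<Omega> \<in> sets lebesgue" "L2 \<Omega> f" "continuous_on UNIV \<phi>" "compact K"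
    and "\<And>p. p \<in> \<Omega> \<Longrightarrow> p \<notin> K \<Longrightarrow> \<phi> p = 0"
  shows "integrable (lebesgue_on \<Omega>) (\<lambda>p. \<phi> p *\<^sub>R f p)"
proof -
  obtain C where C: "\<And>p. p \<in> K \<Longrightarrow> norm (\<phi> p) \<le> C"
    using continuous_bounded_on_compact[OF assms(3,4)] by blast
  show ?thesis
  proof (rule L2_imp_integrable_local[OF assms(1,2) _ assms(4), where C = C])
    show "(\<lambda>p. \<phi> p *\<^sub>R f p) \<in> borel_measurable (lebesgue_on \<Omega>)"
      using assms(2) borel_measurable_continuous_lebesgue_on[OF assms(3,1)]
      by (auto simp: L2_def intro!: borel_measurable_scaleR)
  qed (use C assms(5) in \<open>auto intro: mult_right_mono\<close>)
qed

lemma integrable_L2_scaleR_continuous: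
  fixes \<phi> :: "'a::euclidean_space \<Rightarrow> 'b::euclidean_space" and f :: "'a \<Rightarrow> real"
  assumes "\<Omega> \<in> sets lebesgue" "L2 \<Omega> f" "continuous_on UNIV \<phi>" "compact K"
    and "\<And>p. p \<in> \<Omega> \<Longrightarrow> p \<notin> K \<Longrightarrow> \<phi> p = 0"
  shows "integrable (lebesgue_on \<Omega>) (\<lambda>p. f p *\<^sub>R \<phi> p)"
proof -
  obtain C where C: "\<And>p. p \<in> K \<Longrightarrow> norm (\<phi> p) \<le> C"
    using continuous_bounded_on_compact[OF assms(3,4)] by blast
  show ?thesis
  proof (rule L2_imp_integrable_local[OF assms(1,2) _ assms(4), where C = C])
    show "(\<lambda>p. f p *\<^sub>R \<phi> p) \<in> borel_measurable (lebesgue_on \<Omega>)"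
      using assms(2) borel_measurable_continuous_lebesgue_on[OF assms(3,1)]
      by (auto simp: L2_def intro!: borel_measurable_scaleR)
  qed (use C assms(5) in \<open>auto simp: mult.commute[of "\<bar>f _\<bar>"] intro: mult_right_mono\<close>)
qed

lemma integrable_continuous_rectangle:
  fixes \<phi> :: "real \<times> real \<Rightarrow> 'b::euclidean_space"
  assumes "continuous_on UNIV \<phi>"
  shows "integrable (lebesgue_on (box (a, c) (b, d))) \<phi>"
  by (rule integrable_lebesgue_on_subset[where \<Omega> = "cbox (a, c) (b, d)"])
     (use assms in \<open>auto intro!: continuous_imp_integrable box_subset_cbox intro: continuous_on_subset\<close>)

lemma L2_continuous_rectangle:
  fixes \<phi> :: "real \<times> real \<Rightarrow> 'b::euclidean_space"
  assumes "continuous_on UNIV \<phi>"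
  shows "L2 (box (a, c) (b, d)) \<phi>"
  unfolding L2_def using assms
  by (auto intro!: borel_measurable_continuous_lebesgue_on integrable_continuous_rectangle continuous_intros)

section \<open>Uniqueness of weak gradients on rectangles\<close>

text \<open>These test functions approximate the indicator of the rectangle from below; a margin of width
  \<open>1 / n\<close> is left free on every side, so that the supports are compact.\<close>

definition box_bump :: "real \<Rightarrow> real \<Rightarrow> real \<Rightarrow> real \<Rightarrow> nat \<Rightarrow> real \<times> real \<Rightarrow> real" where
  "box_bump a b c d n p =
     smooth_step (n * (fst p - a) - 1) * smooth_step (n * (b - fst p) - 1) *
     (smooth_step (n * (snd p - c) - 1) * smooth_step (n * (d - snd p) - 1))"

lemma box_bump_range: "0 \<le> box_bump a b c d n p" "box_bump a b c d n p \<le> 1"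
  unfolding box_bump_def by (intro mult_nonneg_nonneg mult_le_one smooth_step_range)+

lemma box_bump_support:
  assumes "box_bump a b c d n p \<noteq> 0"
  shows "p \<in> cbox (a + 1/n, c + 1/n) (b - 1/n, d - 1/n)" "n > 0"
proof -
  have *: "n * t - 1 > 0" if "smooth_step (n * t - 1) \<noteq> 0" for t :: real
    using that smooth_step_eq_0[of "n * t - 1"] by linarith
  have 1: "n * (fst p - a) - 1 > 0" "n * (b - fst p) - 1 > 0" "n * (snd p - c) - 1 > 0" "n * (d - snd p) - 1 > 0"
    using assms unfolding box_bump_def by (auto intro!: *[simplified])
  then show "n > 0" by (cases n) auto
  then have "t \<ge> 1/n" if "n * t - 1 > 0" for t :: real using that by (simp add: field_simps)
  from this[OF 1(1)] this[OF 1(2)] this[OF 1(3)] this[OF 1(4)]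
  show "p \<in> cbox (a + 1/n, c + 1/n) (b - 1/n, d - 1/n)"
    by (simp add: mem_cbox_prod_real)
qed

lemma box_bump_outside: "p \<notin> box (a, c) (b, d) \<Longrightarrow> box_bump a b c d n p = 0"
proof (rule ccontr)
  assume p: "p \<notin> box (a, c) (b, d)" "box_bump a b c d n p \<noteq> 0"
  have "1 / real n > 0" using box_bump_support(2)[OF p(2)] by simp
  moreover have "a + 1 / real n \<le> fst p \<and> fst p \<le> b - 1 / real n \<and> c + 1 / real n \<le> snd p \<and> snd p \<le> d - 1 / real n"
    using box_bump_support(1)[OF p(2)] unfolding mem_cbox_prod_real .
  ultimately show False using p(1) unfolding mem_box_prod_real by linarith
qed

lemma box_bump_test_fun: obtains G where "test_fun (box (a, c) (b, d)) (box_bump a b c d n) G"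
proof -
  obtain G1 where 1: "C1_fun (\<lambda>p :: real \<times> real. smooth_step (real n * fst p + (- real n * a - 1))) G1"
    by (rule C1_fun_step[OF C1_fun_fst])
  obtain G2 where 2: "C1_fun (\<lambda>p :: real \<times> real. smooth_step (- real n * fst p + (real n * b - 1))) G2"
    by (rule C1_fun_step[OF C1_fun_fst])
  obtain G3 where 3: "C1_fun (\<lambda>p :: real \<times> real. smooth_step (real n * snd p + (- real n * c - 1))) G3"
    by (rule C1_fun_step[OF C1_fun_snd])
  obtain G4 where 4: "C1_fun (\<lambda>p :: real \<times> real. smooth_step (- real n * snd p + (real n * d - 1))) G4"
    by (rule C1_fun_step[OF C1_fun_snd])
  have eq: "box_bump a b c d n = (\<lambda>p. smooth_step (real n * fst p + (- real n * a - 1)) *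
      smooth_step (- real n * fst p + (real n * b - 1)) *
      (smooth_step (real n * snd p + (- real n * c - 1)) * smooth_step (- real n * snd p + (real n * d - 1))))"
    by (rule ext) (simp add: box_bump_def algebra_simps)
  have "\<exists>G. C1_fun (box_bump a b c d n) G"
    unfolding eq by (rule exI) (rule C1_fun_mult[OF C1_fun_mult[OF 1 2] C1_fun_mult[OF 3 4]])
  then obtain G where C1: "C1_fun (box_bump a b c d n) G" ..
  define Q where "Q = cbox (a + 1/n, c + 1/n) (b - 1/n, d - 1/n)"
  have sub: "tsupp (box_bump a b c d n) \<subseteq> Q" unfolding tsupp_def Q_def
    by (rule closure_minimal) (use box_bump_support(1) in auto)
  have "compact (tsupp (box_bump a b c d n))"
    using compact_Int_closed[of Q "tsupp (box_bump a b c d n)"] sub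
    by (metis Q_def Int_absorb1 closed_closure compact_cbox tsupp_def)
  moreover have "tsupp (box_bump a b c d n) \<subseteq> box (a, c) (b, d)"
  proof (cases "n = 0")
    case True
    then have "{p. box_bump a b c d n p \<noteq> 0} = {}" using box_bump_support(2) by blast
    then have "tsupp (box_bump a b c d n) = {}" by (simp only: tsupp_def) simp
    then show ?thesis by simp
  next
    case False
    define e where "e = 1 / real n"
    have "e > 0" using False by (simp add: e_def)
    then have "Q \<subseteq> box (a, c) (b, d)"
      by (auto simp: Q_def mem_cbox_prod_real mem_box_prod_real simp flip: e_def)
    then show ?thesis using sub by blast
  qed
  ultimately have "test_fun (box (a, c) (b, d)) (box_bump a b c d n) G"
    unfolding test_fun_def using C1 by blast
  then show ?thesis by (rule that)
qed

lemma box_bump_tendsto: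
  "(\<lambda>n. box_bump a b c d n p) \<longlonglongrightarrow> indicator (box (a, c) (b, d)) p"
proof (cases "p \<in> box (a, c) (b, d)")
  case True
  have *: "\<forall>\<^sub>F n::nat in sequentially. smooth_step (n * t - 1) = 1" if "t > 0" for t :: real
  proof -
    have "\<forall>\<^sub>F n::nat in sequentially. n \<ge> 2 / t"
      using eventually_ge_at_top[of "nat \<lceil>2/t\<rceil>"] by eventually_elim linarith
    then show ?thesis
      by eventually_elim (use that in \<open>auto intro!: smooth_step_eq_1 simp: field_simps\<close>)
  qed
  have t: "fst p - a > 0" "b - fst p > 0" "snd p - c > 0" "d - snd p > 0"
    using True by (auto simp: mem_box_prod_real)
  have "\<forall>\<^sub>F n in sequentially. box_bump a b c d n p = 1"
    using *[OF t(1)] *[OF t(2)] *[OF t(3)] *[OF t(4)]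
    by eventually_elim (simp add: box_bump_def)
  then show ?thesis using True by (simp add: tendsto_eventually)
next
  case False
  then show ?thesis by (simp add: box_bump_outside)
qed

text \<open>Testing with bumps gives a vanishing integral of \<open>q\<close> over every subrectangle. Rectangles form an
  intersection-stable generator of the Borel sets, so the integral vanishes over all Borel sets,
  and over Lebesgue sets because these are Borel up to null sets.\<close>

lemma fundamental_lemma_box:
  fixes q :: "real \<times> real \<Rightarrow> real \<times> real" and a b c d :: real
  defines "R \<equiv> box (a, c) (b, d)"
  assumes q: "integrable (lebesgue_on R) q"
    and test: "\<And>\<phi> D\<phi>. test_fun R \<phi> D\<phi> \<Longrightarrow> (LINT p|lebesgue_on R. \<phi> p *\<^sub>R q p) = 0"
  shows "AE p in lebesgue_on R. q p = 0"
proof -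
  interpret finite_measure "lebesgue_on R"
    by (rule finite_measure_lebesgue_on) (simp add: R_def)
  show ?thesis
  proof (rule density_zero[OF q])
    define Q where "Q p = indicat_real R p *\<^sub>R q p" for p
    have R: "R \<in> sets lebesgue" by (simp add: R_def)
    have Q: "integrable lebesgue Q" using q R by (simp add: integrable_restrict_space Q_def[abs_def])
    \<comment> \<open>The integrals over open rectangles are limits of integrals against bumps.\<close>
    have basic_box: "(LINT p|lebesgue. indicat_real (box u v) p *\<^sub>R Q p) = 0" for u v
    proof -
      obtain u1 u2 v1 v2 where uv: "u = (u1, u2)" "v = (v1, v2)" by (metis surj_pair)
      define a' b' c' d' where "a' = max a u1" "b' = min b v1" "c' = max c u2" "d' = min d v2"
      have B: "box u v \<inter> R = box (a', c') (b', d')"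
        by (auto simp: a'_b'_c'_d'_def R_def uv mem_box_prod_real)
      have "(\<lambda>n. LINT p|lebesgue. box_bump a' b' c' d' n p *\<^sub>R Q p) \<longlonglongrightarrow>
          (LINT p|lebesgue. indicat_real (box u v) p *\<^sub>R Q p)"
      proof (rule integral_dominated_convergence[where w = "\<lambda>p. norm (Q p)"])
        have "indicat_real (box u v) p *\<^sub>R Q p = indicat_real (box (a', c') (b', d')) p *\<^sub>R Q p" for p
          using B by (auto simp: Q_def indicator_def)
        then show "AE p in lebesgue. (\<lambda>n. box_bump a' b' c' d' n p *\<^sub>R Q p) \<longlonglongrightarrow> indicat_real (box u v) p *\<^sub>R Q p"
          by (simp only:) (intro AE_I2 tendsto_intros box_bump_tendsto)
        show "(\<lambda>p. box_bump a' b' c' d' n p *\<^sub>R Q p) \<in> borel_measurable lebesgue" for n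
        proof -
          obtain G where "test_fun (box (a', c') (b', d')) (box_bump a' b' c' d' n) G" by (rule box_bump_test_fun)
          then have "continuous_on UNIV (box_bump a' b' c' d' n)" by (auto simp: test_fun_def intro: C1_fun_continuous)
          then have "box_bump a' b' c' d' n \<in> borel_measurable lborel"
            by (simp add: borel_measurable_continuous_onI)
          then have "box_bump a' b' c' d' n \<in> borel_measurable lebesgue"
            by (rule measurable_completion)
          then show ?thesis using Q by (auto intro!: borel_measurable_scaleR)
        qed
        show "AE p in lebesgue. norm (box_bump a' b' c' d' n p *\<^sub>R Q p) \<le> norm (Q p)" for n
          using box_bump_range by (auto intro!: mult_left_le_one_le)
      qed (use Q in \<open>auto intro!: borel_measurable_scaleR borel_measurable_indicator\<close>)
      moreover have "(LINT p|lebesgue. box_bump a' b' c' d' n p *\<^sub>R Q p) = 0" for n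
      proof -
        obtain G where G: "test_fun (box (a', c') (b', d')) (box_bump a' b' c' d' n) G" by (rule box_bump_test_fun)
        have "test_fun R (box_bump a' b' c' d' n) G"
          using G B unfolding test_fun_def by blast
        from test[OF this] show ?thesis
          using R by (simp add: integral_restrict_space Q_def mult.commute)
      qed
      ultimately show ?thesis using LIMSEQ_unique by fastforce
    qed
    have total: "(LINT p|lebesgue. Q p) = 0"
    proof -
      have "(\<lambda>p. indicat_real R p *\<^sub>R Q p) = Q" by (rule ext) (simp add: Q_def indicator_def)
      then show ?thesis using basic_box[of "(a, c)" "(b, d)"] by (simp only: R_def[symmetric])
    qed
    have borel: "(LINT p|lebesgue. indicat_real A p *\<^sub>R Q p) = 0" if "A \<in> sets borel" for A
    proof -
      have SB: "sigma_sets UNIV (range (\<lambda>(a, b). box a b :: (real \<times> real) set)) = sets borel"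
        by (subst borel_eq_box) simp
      have A: "A \<in> sigma_sets UNIV (range (\<lambda>(a, b). box a b :: (real \<times> real) set))"
        using that unfolding SB .
      have S: "B \<in> sets lebesgue" if "B \<in> sigma_sets UNIV (range (\<lambda>(a, b). box a b :: (real \<times> real) set))" for B
        using that unfolding SB by (simp add: sets_completionI_sets)
      have st: "Int_stable (range (\<lambda>(a, b). box a b :: (real \<times> real) set))"
      proof (rule Int_stableI)
        fix A B :: "(real \<times> real) set"
        assume "A \<in> range (\<lambda>(a, b). box a b)" "B \<in> range (\<lambda>(a, b). box a b)"
        then obtain u1 u2 v1 v2 w1 w2 z1 z2 :: real
          where AB: "A = box (u1, u2) (v1, v2)" "B = box (w1, w2) (z1, z2)" by auto
        have "A \<inter> B = box (max u1 w1, max u2 w2) (min v1 z1, min v2 z2)"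
          unfolding AB by (auto simp: mem_box_prod_real)
        then show "A \<inter> B \<in> range (\<lambda>(a, b). box a b)"
          by (simp add: range_eqI[of _ _ "((max u1 w1, max u2 w2), (min v1 z1, min v2 z2))"])
      qed
      have sub: "range (\<lambda>(a, b). box a b :: (real \<times> real) set) \<subseteq> Pow UNIV" by simp
      from st sub A show ?thesis
      proof (induction rule: sigma_sets_induct_disjoint)
        case (basic A) then show ?case using basic_box by auto
      next
        case (compl A)
        have "(\<lambda>p. indicat_real (UNIV - A) p *\<^sub>R Q p) = (\<lambda>p. Q p - indicat_real A p *\<^sub>R Q p)"
          by (rule ext) (simp add: indicator_def)
        then show ?case
          using compl total Bochner_Integration.integral_diff[OF Q integrable_mult_indicator[OF S[OF compl(1)] Q]]
          by simp
      next
        case (union A)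
        have "(LINT p:(\<Union>i. A i)|lebesgue. Q p) = (\<Sum>i. LINT p:A i|lebesgue. Q p)"
        proof (rule lebesgue_integral_countable_add)
          show "A i \<in> sets lebesgue" for i using union S by auto
          then have "(\<Union>i. A i) \<in> sets lebesgue" by auto
          then show "set_integrable lebesgue (\<Union>i. A i) Q"
            unfolding set_integrable_def using Q by (rule integrable_mult_indicator)
          show "A i \<inter> A j = {}" if "i \<noteq> j" for i j
            using union(1) that by (auto simp: disjoint_family_on_def)
        qed
        then show ?case using union by (simp add: set_lebesgue_integral_def)
      qed auto
    qed
    fix A assume A: "A \<in> sets (lebesgue_on R)"
    then have A': "A \<in> sets lebesgue" "A \<subseteq> R" using R by (auto simp: sets_restrict_space_iff)
    obtain B N N' where B: "A = B \<union> N" "N \<subseteq> N'" "N' \<in> null_sets lborel" "B \<in> sets lborel"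
      using sets_completionE[OF A'(1)] by metis
    have "AE p in lebesgue. p \<notin> N'" using B(3) AE_not_in null_sets_completionI by blast
    then have "AE p in lebesgue. indicat_real A p *\<^sub>R Q p = indicat_real B p *\<^sub>R Q p"
      by (rule AE_mp) (use B in \<open>auto simp: indicator_def intro!: AE_I2\<close>)
    moreover have "B \<in> sets lebesgue" using B by (simp add: sets_completionI_sets)
    ultimately have "(LINT p|lebesgue. indicat_real A p *\<^sub>R Q p) = (LINT p|lebesgue. indicat_real B p *\<^sub>R Q p)"
      using Q A' by (intro integral_cong_AE) (auto intro!: borel_measurable_scaleR borel_measurable_indicator borel_measurable_integrable)
    then show "set_lebesgue_integral (lebesgue_on R) A q = 0"
      using borel[of B] B R by (simp add: set_lebesgue_integral_def integral_restrict_space Q_def mult.commute)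
  qed
qed

lemma test_fun_grad_0:
  assumes "test_fun \<Omega> \<phi> D\<phi>" "p \<notin> tsupp \<phi>" shows "D\<phi> p = 0"
proof (rule C1_fun_eq_0_imp_grad_0[where f = \<phi> and F = D\<phi> and p = p and U = "- tsupp \<phi>"])
  show "open (- tsupp \<phi>)" unfolding tsupp_def by (intro open_Compl closed_closure)
  show "\<phi> q = 0" if "q \<in> - tsupp \<phi>" for q
    using that closure_subset[of "{x. \<phi> x \<noteq> 0}"] by (auto simp: tsupp_def)
qed (use assms in \<open>auto simp: test_fun_def\<close>)

lemma tsupp_eq_0: "p \<notin> tsupp \<phi> \<Longrightarrow> \<phi> p = 0"
  using closure_subset[of "{x. \<phi> x \<noteq> 0}"] by (auto simp: tsupp_def)

lemma has_weak_gradient_subset: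
  assumes u: "has_weak_gradient \<Omega> u g" and R: "R \<subseteq> \<Omega>" "open R" "open \<Omega>"
  shows "has_weak_gradient R u g"
proof -
  have R': "R \<in> sets lebesgue" "\<Omega> \<in> sets lebesgue" using R by (auto intro: borel_open sets_completionI_sets simp: lborelD)
  show ?thesis unfolding has_weak_gradient_def
  proof (intro conjI allI impI)
    have "L2 \<Omega> g" using u by (simp add: has_weak_gradient_def)
    then show "L2 R g" by (rule L2_subset[OF _ R(1) R'])
    fix \<phi> D\<phi> assume t: "test_fun R \<phi> D\<phi>"
    then have "test_fun \<Omega> \<phi> D\<phi>" using R by (auto simp: test_fun_def)
    then have "(LINT x|lebesgue_on \<Omega>. u x *\<^sub>R D\<phi> x) = - (LINT x|lebesgue_on \<Omega>. \<phi> x *\<^sub>R g x)"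
      using u by (simp add: has_weak_gradient_def)
    moreover have z: "D\<phi> p = 0" "\<phi> p = 0" if "p \<in> \<Omega> - R" for p
      using that t test_fun_grad_0[OF t] tsupp_eq_0[of p \<phi>] by (auto simp: test_fun_def)
    ultimately show "(LINT x|lebesgue_on R. u x *\<^sub>R D\<phi> x) = - (LINT x|lebesgue_on R. \<phi> x *\<^sub>R g x)"
      using lebesgue_integral_on_subset[OF R(1) R', of "\<lambda>x. u x *\<^sub>R D\<phi> x"] z
        lebesgue_integral_on_subset[OF R(1) R', of "\<lambda>x. \<phi> x *\<^sub>R g x"] by simp
  qed
qed

text \<open>The weak gradient in the definitions of the energy and of the trace is an arbitrary choice;
  by uniqueness it may be replaced by any weak gradient at hand.\<close>

lemma weak_gradient_unique_box:
  fixes a b c d :: real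
  assumes "has_weak_gradient (box (a, c) (b, d)) u g" "has_weak_gradient (box (a, c) (b, d)) u g'"
  shows "AE p in lebesgue_on (box (a, c) (b, d)). g p = g' p"
proof -
  let ?R = "box (a, c) (b, d)"
  have L: "L2 ?R g" "L2 ?R g'" using assms by (auto simp: has_weak_gradient_def)
  have K: "p \<in> ?R \<Longrightarrow> p \<notin> cbox (a, c) (b, d) \<Longrightarrow> z = 0" for p and z :: real
    using box_subset_cbox by blast
  have int: "integrable (lebesgue_on ?R) (\<lambda>p. \<phi> p *\<^sub>R f p)"
    if "L2 ?R f" "continuous_on UNIV \<phi>" for f :: "real \<times> real \<Rightarrow> real \<times> real" and \<phi> :: "real \<times> real \<Rightarrow> real"
    by (rule integrable_continuous_scaleR_L2[OF _ that compact_cbox K]) auto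
  have "AE p in lebesgue_on ?R. g p - g' p = 0"
  proof (rule fundamental_lemma_box)
    have "integrable (lebesgue_on ?R) g" "integrable (lebesgue_on ?R) g'"
      using int[OF L(1), of "\<lambda>_. 1"] int[OF L(2), of "\<lambda>_. 1"] by auto
    then show "integrable (lebesgue_on ?R) (\<lambda>p. g p - g' p)" by (rule Bochner_Integration.integrable_diff)
    fix \<phi> D\<phi> assume t: "test_fun ?R \<phi> D\<phi>"
    then have c: "continuous_on UNIV \<phi>" by (auto simp: test_fun_def intro: C1_fun_continuous)
    have "(LINT p|lebesgue_on ?R. \<phi> p *\<^sub>R (g p - g' p)) =
        (LINT p|lebesgue_on ?R. \<phi> p *\<^sub>R g p) - (LINT p|lebesgue_on ?R. \<phi> p *\<^sub>R g' p)"
      unfolding scaleR_diff_right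
      by (rule Bochner_Integration.integral_diff[OF int[OF L(1) c] int[OF L(2) c]])
    also have "\<dots> = 0"
    proof -
      have "(LINT p|lebesgue_on ?R. u p *\<^sub>R D\<phi> p) = - (LINT p|lebesgue_on ?R. \<phi> p *\<^sub>R g p)"
        "(LINT p|lebesgue_on ?R. u p *\<^sub>R D\<phi> p) = - (LINT p|lebesgue_on ?R. \<phi> p *\<^sub>R g' p)"
        using assms t unfolding has_weak_gradient_def by blast+
      then show ?thesis by simp
    qed
    finally show "(LINT p|lebesgue_on ?R. \<phi> p *\<^sub>R (g p - g' p)) = 0" .
  qed
  then show ?thesis by simp
qed

section \<open>Green's formula and traces on rectangles\<close>

lemma C1_fun_partial_derivatives:
  fixes F :: "real \<times> real \<Rightarrow> real"
  assumes "C1_fun F DF"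
  shows "((\<lambda>x. F (x, y)) has_real_derivative fst (DF (x, y))) (at x)"
    and "((\<lambda>y. F (x, y)) has_real_derivative snd (DF (x, y))) (at y)"
proof -
  have D: "(F has_derivative (\<lambda>h. h \<bullet> DF p)) (at p)" for p
    using assms unfolding C1_fun_def gderiv_def by blast
  have "((\<lambda>x. (x, y)) has_derivative (\<lambda>h. (h, 0))) (at x)" by (auto intro!: derivative_eq_intros)
  from has_derivative_compose[OF this D]
  have "((\<lambda>x. F (x, y)) has_derivative (\<lambda>h. (h, 0) \<bullet> DF (x, y))) (at x)" .
  moreover have "(\<lambda>h. (h, 0) \<bullet> DF (x, y)) = (*) (fst (DF (x, y)))"
    by (rule ext) (simp add: inner_prod_def mult.commute)
  ultimately show "((\<lambda>x. F (x, y)) has_real_derivative fst (DF (x, y))) (at x)"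
    by (simp add: has_field_derivative_def)
  have "((\<lambda>y. (x, y)) has_derivative (\<lambda>h. (0, h))) (at y)" by (auto intro!: derivative_eq_intros)
  from has_derivative_compose[OF this D]
  have "((\<lambda>y. F (x, y)) has_derivative (\<lambda>h. (0, h) \<bullet> DF (x, y))) (at y)" .
  moreover have "(\<lambda>h. (0, h) \<bullet> DF (x, y)) = (*) (snd (DF (x, y)))"
    by (rule ext) (simp add: inner_prod_def mult.commute)
  ultimately show "((\<lambda>y. F (x, y)) has_real_derivative snd (DF (x, y))) (at y)"
    by (simp add: has_field_derivative_def)
qed

text \<open>Green's formula for functions that vanish on three sides, so that only the bottom contributes.\<close>

lemma integral_gradient_rectangle:
  fixes F :: "real \<times> real \<Rightarrow> real" and a b c d :: real
  assumes F: "C1_fun F DF" and ab: "a < b" "c < d"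
    and side: "\<And>y. y \<in> {c..d} \<Longrightarrow> F (a, y) = 0" "\<And>y. y \<in> {c..d} \<Longrightarrow> F (b, y) = 0"
    and top: "\<And>x. x \<in> {a..b} \<Longrightarrow> F (x, d) = 0"
  shows "(LINT p|lebesgue_on (box (a, c) (b, d)). DF p) = (0, - (LINT x|lebesgue_on {a<..<b}. F (x, c)))"
proof -
  let ?R = "box (a, c) (b, d)"
  have cont: "continuous_on UNIV DF" "continuous_on UNIV F"
    using F C1_fun_continuous[OF F] by (auto simp: C1_fun_def)
  have c1: "continuous_on S (\<lambda>p. fst (DF p))" "continuous_on S (\<lambda>p. snd (DF p))" for S
    by (auto intro!: continuous_intros continuous_on_subset[OF cont(1)])
  have int: "integrable (lebesgue_on ?R) DF" by (rule integrable_continuous_rectangle[OF cont(1)])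
  have HK: "(LINT p|lebesgue_on ?R. f p) = integral (cbox (a, c) (b, d)) f"
    if "continuous_on UNIV f" for f :: "real \<times> real \<Rightarrow> real"
    using integrable_continuous_rectangle[OF that]
    by (simp add: lebesgue_integral_eq_integral integral_open_interval)
  have "fst (LINT p|lebesgue_on ?R. DF p) = (LINT p|lebesgue_on ?R. fst (DF p))"
    using integral_bounded_linear[OF bounded_linear_fst int] by simp
  also have "\<dots> = integral (cbox (a, c) (b, d)) (\<lambda>p. fst (DF p))" by (rule HK[OF c1(1)])
  also have "\<dots> = integral (cbox a b) (\<lambda>x. integral (cbox c d) (\<lambda>y. fst (DF (x, y))))"
    by (rule integral_prod_continuous[OF c1(1)])
  also have "\<dots> = integral (cbox c d) (\<lambda>y. integral (cbox a b) (\<lambda>x. fst (DF (x, y))))"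
    using integral_swap_continuous[of a c b d "\<lambda>x y. fst (DF (x, y))"] c1(1) by (simp add: case_prod_unfold)
  also have "\<dots> = integral (cbox c d) (\<lambda>y. 0)"
  proof (rule integral_cong)
    fix y assume y: "y \<in> cbox c d"
    have "((\<lambda>x. fst (DF (x, y))) has_integral F (b, y) - F (a, y)) {a..b}"
      using ab C1_fun_partial_derivatives(1)[OF F]
      by (intro fundamental_theorem_of_calculus)
         (auto simp flip: has_real_derivative_iff_has_vector_derivative intro: has_field_derivative_at_within)
    then show "integral (cbox a b) (\<lambda>x. fst (DF (x, y))) = 0" using side y by (auto simp: integral_unique)
  qed
  finally have 1: "fst (LINT p|lebesgue_on ?R. DF p) = 0" by simp
  have "snd (LINT p|lebesgue_on ?R. DF p) = (LINT p|lebesgue_on ?R. snd (DF p))"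
    using integral_bounded_linear[OF bounded_linear_snd int] by simp
  also have "\<dots> = integral (cbox (a, c) (b, d)) (\<lambda>p. snd (DF p))" by (rule HK[OF c1(2)])
  also have "\<dots> = integral (cbox a b) (\<lambda>x. integral (cbox c d) (\<lambda>y. snd (DF (x, y))))"
    by (rule integral_prod_continuous[OF c1(2)])
  also have "\<dots> = integral (cbox a b) (\<lambda>x. - F (x, c))"
  proof (rule integral_cong)
    fix x assume x: "x \<in> cbox a b"
    have "((\<lambda>y. snd (DF (x, y))) has_integral F (x, d) - F (x, c)) {c..d}"
      using ab C1_fun_partial_derivatives(2)[OF F]
      by (intro fundamental_theorem_of_calculus)
         (auto simp flip: has_real_derivative_iff_has_vector_derivative intro: has_field_derivative_at_within)
    then show "integral (cbox c d) (\<lambda>y. snd (DF (x, y))) = - F (x, c)" using top x by (auto simp: integral_unique)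
  qed
  also have "\<dots> = - integral {a<..<b} (\<lambda>x. F (x, c))"
    by (simp add: integral_open_interval_real)
  also have "integral {a<..<b} (\<lambda>x. F (x, c)) = (LINT x|lebesgue_on {a<..<b}. F (x, c))"
  proof (rule lebesgue_integral_eq_integral[symmetric])
    have "integrable (lebesgue_on (cbox a b)) (\<lambda>x. F (x, c))"
      by (intro continuous_imp_integrable continuous_on_compose2[OF cont(2)]) (auto intro!: continuous_intros)
    then show "integrable (lebesgue_on {a<..<b}) (\<lambda>x. F (x, c))"
      by (rule integrable_lebesgue_on_subset) auto
  qed auto
  finally have 2: "snd (LINT p|lebesgue_on ?R. DF p) = - (LINT x|lebesgue_on {a<..<b}. F (x, c))" .
  show ?thesis using 1 2 by (simp add: prod_eq_iff)
qed

text \<open>On a finite measure space convergence in L2 implies convergence in L1: for every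
  \<open>\<epsilon> > 0\<close> the bound \<open>t \<le> \<epsilon> + t\<^sup>2 / \<epsilon>\<close> holds.\<close>

lemma integral_tendsto_of_L2:
  fixes F :: "nat \<Rightarrow> 'a \<Rightarrow> 'b::euclidean_space" and e :: "nat \<Rightarrow> 'a \<Rightarrow> real"
  assumes "finite_measure M" and F: "\<And>n. integrable M (F n)" "integrable M G"
    and e: "\<And>n. integrable M (\<lambda>x. (e n x)\<^sup>2)"
    and bound: "\<And>n. AE x in M. norm (F n x - G x) \<le> C * \<bar>e n x\<bar>"
    and s: "\<And>n. (LINT x|M. (e n x)\<^sup>2) \<le> s n" "s \<longlonglongrightarrow> 0"
  shows "(\<lambda>n. LINT x|M. F n x) \<longlonglongrightarrow> (LINT x|M. G x)"
proof (rule LIMSEQ_I)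
  interpret finite_measure M by fact
  fix r :: real assume r: "r > 0"
  define m where "m = measure M (space M) + 1"
  define D where "D = \<bar>C\<bar> + 1"
  \<comment> \<open>Chosen so that the contribution of the constant part is at most \<open>r / 2\<close>; the increments by \<open>1\<close> in \<open>m\<close> and \<open>D\<close> avoid division by zero.\<close>
  define \<epsilon> where "\<epsilon> = r / (2 * D * m)"
  have pos: "m > 0" "D > 0" by (auto simp: m_def D_def intro: add_nonneg_pos)
  then have eps: "\<epsilon> > 0" using r by (simp add: \<epsilon>_def)
  have bnd: "norm ((LINT x|M. F n x) - (LINT x|M. G x)) \<le> r / 2 + D / \<epsilon> * s n" for n
  proof -
    have "norm ((LINT x|M. F n x) - (LINT x|M. G x)) = norm (LINT x|M. F n x - G x)"
      using F by simp
    also have "\<dots> \<le> (LINT x|M. norm (F n x - G x))" by (rule integral_norm_bound)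
    also have "\<dots> \<le> (LINT x|M. D * (\<epsilon> + (e n x)\<^sup>2 / \<epsilon>))"
    proof (rule integral_mono_AE)
      show "AE x in M. norm (F n x - G x) \<le> D * (\<epsilon> + (e n x)\<^sup>2 / \<epsilon>)"
        using bound[of n]
      proof eventually_elim
        case (elim x)
        have "\<bar>e n x\<bar> \<le> \<epsilon> + (e n x)\<^sup>2 / \<epsilon>"
        proof (cases "\<bar>e n x\<bar> \<le> \<epsilon>")
          case False
          then have "\<epsilon> * \<bar>e n x\<bar> \<le> \<bar>e n x\<bar> * \<bar>e n x\<bar>" by (intro mult_right_mono) auto
          then have "\<bar>e n x\<bar> \<le> (e n x)\<^sup>2 / \<epsilon>"
            using eps by (simp add: power2_eq_square pos_le_divide_eq mult.commute)
          then show ?thesis using eps by linarith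
        qed (use eps in \<open>auto intro: add_increasing2\<close>)
        then have "D * \<bar>e n x\<bar> \<le> D * (\<epsilon> + (e n x)\<^sup>2 / \<epsilon>)"
          using pos by (intro mult_left_mono) auto
        moreover have "C * \<bar>e n x\<bar> \<le> D * \<bar>e n x\<bar>" by (intro mult_right_mono) (auto simp: D_def)
        ultimately show ?case using elim by linarith
      qed
    qed (use F e in auto)
    also have "\<dots> = D * (\<epsilon> * measure M (space M) + (LINT x|M. (e n x)\<^sup>2) / \<epsilon>)"
      using e[of n] by simp
    also have "\<dots> \<le> D * (\<epsilon> * m + s n / \<epsilon>)"
      using eps pos s(1)[of n] by (intro mult_left_mono add_mono divide_right_mono) (auto simp: m_def)
    also have "\<dots> = r / 2 + D / \<epsilon> * s n"
      using pos by (simp add: \<epsilon>_def field_simps)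
    finally show ?thesis .
  qed
  have "(\<lambda>n. r / 2 + D / \<epsilon> * s n) \<longlonglongrightarrow> r / 2 + D / \<epsilon> * 0"
    by (intro tendsto_intros s)
  moreover have "r / 2 + D / \<epsilon> * 0 < r" using r by simp
  ultimately have "\<forall>\<^sub>F n in sequentially. r / 2 + D / \<epsilon> * s n < r" by (rule order_tendstoD)
  then obtain N where "\<And>n. n \<ge> N \<Longrightarrow> r / 2 + D / \<epsilon> * s n < r"
    unfolding eventually_sequentially by blast
  then show "\<exists>N. \<forall>n\<ge>N. norm ((LINT x|M. F n x) - (LINT x|M. G x)) < r"
    using bnd order_le_less_trans by blast
qed

lemma L2_diff:
  fixes f g :: "'a::euclidean_space \<Rightarrow> 'b::euclidean_space"
  assumes "L2 \<Omega> f" "L2 \<Omega> g"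
  shows "L2 \<Omega> (\<lambda>x. f x - g x)"
proof -
  have m: "(\<lambda>x. f x - g x) \<in> borel_measurable (lebesgue_on \<Omega>)"
    using assms by (auto simp: L2_def)
  have "integrable (lebesgue_on \<Omega>) (\<lambda>x. (norm (f x - g x))\<^sup>2)"
  proof (rule Bochner_Integration.integrable_bound)
    show "integrable (lebesgue_on \<Omega>) (\<lambda>x. 2 * (norm (f x))\<^sup>2 + 2 * (norm (g x))\<^sup>2)"
      using assms by (auto simp: L2_def)
    show "(\<lambda>x. (norm (f x - g x))\<^sup>2) \<in> borel_measurable (lebesgue_on \<Omega>)" using m by auto
    have "(norm (f x - g x))\<^sup>2 \<le> 2 * (norm (f x))\<^sup>2 + 2 * (norm (g x))\<^sup>2" for x
    proof -
      have "(norm (f x - g x))\<^sup>2 \<le> (norm (f x) + norm (g x))\<^sup>2"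
        by (intro power_mono norm_triangle_ineq4) auto
      also have "\<dots> \<le> 2 * (norm (f x))\<^sup>2 + 2 * (norm (g x))\<^sup>2"
        using zero_le_power2[of "norm (f x) - norm (g x)"] by (simp add: power2_eq_square algebra_simps)
      finally show ?thesis .
    qed
    then show "AE x in lebesgue_on \<Omega>. norm ((norm (f x - g x))\<^sup>2) \<le> norm (2 * (norm (f x))\<^sup>2 + 2 * (norm (g x))\<^sup>2)"
      by auto
  qed
  then show ?thesis using m by (simp add: L2_def)
qed

lemma has_weak_gradient_weak_grad:
  "has_weak_gradient \<Omega> u g \<Longrightarrow> has_weak_gradient \<Omega> u (weak_grad \<Omega> u)"
  unfolding weak_grad_def by (rule someI[where P = "has_weak_gradient \<Omega> u"])

text \<open>Green's formula with the trace as boundary value: it holds for the C1 functions that define the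
  trace, and each of its three terms passes to the limit by convergence in L2.\<close>

lemma bottom_trace_integral:
  fixes a b c :: real and \<phi> :: "real \<times> real \<Rightarrow> real"
  defines "R \<equiv> box (a, 0) (b, c)"
  assumes ab: "a < b" "0 < c"
    and u: "L2 R u" "has_weak_gradient R u g"
    and T: "bottom_trace a b c u T"
    and \<phi>: "C1_fun \<phi> D\<phi>"
    and side: "\<And>y. y \<in> {0..c} \<Longrightarrow> \<phi> (a, y) = 0" "\<And>y. y \<in> {0..c} \<Longrightarrow> \<phi> (b, y) = 0"
    and top: "\<And>x. x \<in> {a..b} \<Longrightarrow> \<phi> (x, c) = 0"
  shows "(LINT p|lebesgue_on R. u p *\<^sub>R D\<phi> p) + (LINT p|lebesgue_on R. \<phi> p *\<^sub>R g p)
       = (0, - (LINT x|lebesgue_on {a<..<b}. T x * \<phi> (x, 0)))"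
proof -
  let ?K = "cbox (a, 0) (b, c)" and ?I = "{a<..<b}"
  define w where "w = weak_grad R u"
  obtain v Dv where v: "\<And>n. C1_fun (v n) (Dv n)"
    and conv: "(\<lambda>n. LINT p|lebesgue_on R. (v n p - u p)\<^sup>2 + (norm (Dv n p - w p))\<^sup>2) \<longlonglongrightarrow> 0"
    and conv0: "(\<lambda>n. LINT x|lebesgue_on ?I. (v n (x, 0) - T x)\<^sup>2) \<longlonglongrightarrow> 0"
    and TL2: "L2 ?I T"
    using T unfolding bottom_trace_def Let_def R_def w_def box_eq_rectangle by blast
  have w: "has_weak_gradient R u w" unfolding w_def by (rule has_weak_gradient_weak_grad[OF u(2)])
  then have wL2: "L2 R w" by (simp add: has_weak_gradient_def)
  have gw: "AE p in lebesgue_on R. g p = w p"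
    using weak_gradient_unique_box u(2) w unfolding R_def by blast
  have R: "R \<in> sets lebesgue" "R \<subseteq> ?K" by (auto simp: R_def box_subset_cbox)
  have K: "p \<in> R \<Longrightarrow> p \<notin> ?K \<Longrightarrow> z = 0" for p and z :: "'b::zero"
    using R by blast
  have fin: "finite_measure (lebesgue_on R)" "finite_measure (lebesgue_on ?I)"
    by (auto intro!: finite_measure_lebesgue_on simp: R_def)
  have c\<phi>: "continuous_on UNIV \<phi>" "continuous_on UNIV D\<phi>"
    using \<phi> by (auto intro: C1_fun_continuous C1_fun_grad_continuous)
  have cv: "continuous_on UNIV (v n)" "continuous_on UNIV (Dv n)" for n
    using v by (auto intro: C1_fun_continuous C1_fun_grad_continuous)
  obtain C1 where C1: "\<And>p. p \<in> ?K \<Longrightarrow> norm (D\<phi> p) \<le> C1"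
    using continuous_bounded_on_compact[OF c\<phi>(2) compact_cbox] by blast
  obtain C2 where C2: "\<And>p. p \<in> ?K \<Longrightarrow> norm (\<phi> p) \<le> C2"
    using continuous_bounded_on_compact[OF c\<phi>(1) compact_cbox] by blast
  have vL2: "L2 R (v n)" "L2 R (Dv n)" for n
    using L2_continuous_rectangle cv unfolding R_def by blast+
  have sq: "integrable (lebesgue_on R) (\<lambda>p. (v n p - u p)\<^sup>2)"
    "integrable (lebesgue_on R) (\<lambda>p. (norm (Dv n p - w p))\<^sup>2)" for n
    using L2_diff[OF vL2(1) u(1), of n] L2_diff[OF vL2(2) wL2, of n] by (auto simp: L2_def)
  have int_v: "integrable (lebesgue_on R) (\<lambda>p. v n p *\<^sub>R D\<phi> p)" for n
    by (rule integrable_L2_scaleR_continuous[OF R(1) vL2(1) c\<phi>(2) compact_cbox K])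
  have int_u: "integrable (lebesgue_on R) (\<lambda>p. u p *\<^sub>R D\<phi> p)"
    by (rule integrable_L2_scaleR_continuous[OF R(1) u(1) c\<phi>(2) compact_cbox K])
  have int_Dv: "integrable (lebesgue_on R) (\<lambda>p. \<phi> p *\<^sub>R Dv n p)" for n
    by (rule integrable_continuous_scaleR_L2[OF R(1) vL2(2) c\<phi>(1) compact_cbox K])
  have int_g: "integrable (lebesgue_on R) (\<lambda>p. \<phi> p *\<^sub>R g p)"
    by (rule integrable_continuous_scaleR_L2[OF R(1) _ c\<phi>(1) compact_cbox K])
       (use u(2) in \<open>auto simp: has_weak_gradient_def\<close>)
  have 1: "(\<lambda>n. LINT p|lebesgue_on R. v n p *\<^sub>R D\<phi> p) \<longlonglongrightarrow> (LINT p|lebesgue_on R. u p *\<^sub>R D\<phi> p)"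
  proof (rule integral_tendsto_of_L2[OF fin(1) int_v int_u sq(1) _ _ conv])
    show "AE p in lebesgue_on R. norm (v n p *\<^sub>R D\<phi> p - u p *\<^sub>R D\<phi> p) \<le> C1 * \<bar>v n p - u p\<bar>" for n
    proof (rule AE_I2)
      fix p assume "p \<in> space (lebesgue_on R)"
      then have "p \<in> ?K" using R by auto
      then show "norm (v n p *\<^sub>R D\<phi> p - u p *\<^sub>R D\<phi> p) \<le> C1 * \<bar>v n p - u p\<bar>"
        using mult_right_mono[OF C1, of p "\<bar>v n p - u p\<bar>"]
        by (simp flip: scaleR_diff_left add: mult.commute)
    qed
    show "(LINT p|lebesgue_on R. (v n p - u p)\<^sup>2) \<le>
        (LINT p|lebesgue_on R. (v n p - u p)\<^sup>2 + (norm (Dv n p - w p))\<^sup>2)" for n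
      using sq by (intro integral_mono) auto
  qed
  have 2: "(\<lambda>n. LINT p|lebesgue_on R. \<phi> p *\<^sub>R Dv n p) \<longlonglongrightarrow> (LINT p|lebesgue_on R. \<phi> p *\<^sub>R g p)"
  proof (rule integral_tendsto_of_L2[OF fin(1) int_Dv int_g sq(2) _ _ conv])
    show "AE p in lebesgue_on R. norm (\<phi> p *\<^sub>R Dv n p - \<phi> p *\<^sub>R g p) \<le> C2 * \<bar>norm (Dv n p - w p)\<bar>" for n
      using gw AE_space
    proof eventually_elim
      case (elim p)
      then have "p \<in> ?K" using R by auto
      then show ?case
        using mult_right_mono[OF C2, of p "norm (Dv n p - w p)"] elim by (simp flip: scaleR_diff_right)
    qed
    show "(LINT p|lebesgue_on R. (norm (Dv n p - w p))\<^sup>2) \<le>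
        (LINT p|lebesgue_on R. (v n p - u p)\<^sup>2 + (norm (Dv n p - w p))\<^sup>2)" for n
      using sq by (intro integral_mono) auto
  qed
  have I: "?I \<in> sets lebesgue" "?I \<subseteq> cbox a b" by auto
  have cv0: "continuous_on UNIV (\<lambda>x. f (x, 0))" if "continuous_on UNIV f" for f :: "real \<times> real \<Rightarrow> real"
    by (rule continuous_on_compose2[OF that]) (auto intro!: continuous_intros)
  have L2I: "L2 ?I f" if "continuous_on UNIV f" for f :: "real \<Rightarrow> real"
  proof -
    have "continuous_on S (\<lambda>x. (norm (f x))\<^sup>2)" for S
      by (intro continuous_intros continuous_on_subset[OF that]) auto
    then have "integrable (lebesgue_on (cbox a b)) (\<lambda>x. (norm (f x))\<^sup>2)" by (intro continuous_imp_integrable)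
    then have "integrable (lebesgue_on ?I) (\<lambda>x. (norm (f x))\<^sup>2)"
      by (rule integrable_lebesgue_on_subset) auto
    then show ?thesis unfolding L2_def using that borel_measurable_continuous_lebesgue_on I(1) by blast
  qed
  have KI: "x \<in> ?I \<Longrightarrow> x \<notin> cbox a b \<Longrightarrow> z = 0" for x and z :: "'b::zero"
    using I by blast
  have intI: "integrable (lebesgue_on ?I) (\<lambda>x. f x * \<phi> (x, 0))" if "L2 ?I f" for f :: "real \<Rightarrow> real"
    using integrable_L2_scaleR_continuous[OF I(1) that cv0[OF c\<phi>(1)] compact_cbox KI] by simp
  have 3: "(\<lambda>n. LINT x|lebesgue_on ?I. v n (x, 0) * \<phi> (x, 0)) \<longlonglongrightarrow> (LINT x|lebesgue_on ?I. T x * \<phi> (x, 0))"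
  proof (rule integral_tendsto_of_L2[OF fin(2) _ _ _ _ _ conv0])
    show "AE x in lebesgue_on ?I. norm (v n (x, 0) * \<phi> (x, 0) - T x * \<phi> (x, 0)) \<le> C2 * \<bar>v n (x, 0) - T x\<bar>" for n
    proof (rule AE_I2)
      fix x assume "x \<in> space (lebesgue_on ?I)"
      then have "(x, 0) \<in> ?K" using ab by (auto simp: mem_cbox_prod_real)
      then have "\<bar>\<phi> (x, 0)\<bar> \<le> C2" using C2[of "(x, 0)"] by simp
      then show "norm (v n (x, 0) * \<phi> (x, 0) - T x * \<phi> (x, 0)) \<le> C2 * \<bar>v n (x, 0) - T x\<bar>"
        using mult_right_mono[of "\<bar>\<phi> (x, 0)\<bar>" C2 "\<bar>v n (x, 0) - T x\<bar>"]
        unfolding left_diff_distrib[symmetric] by (simp add: abs_mult mult.commute)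
    qed
    show "integrable (lebesgue_on ?I) (\<lambda>x. (v n (x, 0) - T x)\<^sup>2)" for n
      using L2_diff[OF L2I[OF cv0[OF cv(1)]] TL2, of n] by (simp add: L2_def)
  qed (use intI L2I[OF cv0[OF cv(1)]] TL2 in auto)
  have green: "(LINT p|lebesgue_on R. v n p *\<^sub>R D\<phi> p) + (LINT p|lebesgue_on R. \<phi> p *\<^sub>R Dv n p)
      = (0, - (LINT x|lebesgue_on ?I. v n (x, 0) * \<phi> (x, 0)))" for n
  proof -
    have "(LINT p|lebesgue_on R. v n p *\<^sub>R D\<phi> p + \<phi> p *\<^sub>R Dv n p)
      = (0, - (LINT x|lebesgue_on ?I. v n (x, 0) * \<phi> (x, 0)))"
      unfolding R_def
      by (rule integral_gradient_rectangle[OF C1_fun_mult[OF v \<phi>] ab]) (use side top in auto)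
    then show ?thesis
      using Bochner_Integration.integral_add[OF int_v int_Dv] by simp
  qed
  have "(\<lambda>n. (0::real, - (LINT x|lebesgue_on ?I. v n (x, 0) * \<phi> (x, 0)))) \<longlonglongrightarrow>
      (LINT p|lebesgue_on R. u p *\<^sub>R D\<phi> p) + (LINT p|lebesgue_on R. \<phi> p *\<^sub>R g p)"
    using tendsto_add[OF 1 2] unfolding green .
  moreover have "(\<lambda>n. (0::real, - (LINT x|lebesgue_on ?I. v n (x, 0) * \<phi> (x, 0)))) \<longlonglongrightarrow>
      (0, - (LINT x|lebesgue_on ?I. T x * \<phi> (x, 0)))"
    by (intro tendsto_intros 3)
  ultimately show ?thesis by (rule LIMSEQ_unique)
qed

lemma bottom_trace_fst:
  fixes a b c :: real
  assumes g: "has_weak_gradient (box (a, 0) (b, c)) fst (\<lambda>p. (1, 0))"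
  shows "bottom_trace a b c fst (\<lambda>x. x)"
proof -
  let ?R = "box (a, 0) (b, c)"
  have "has_weak_gradient ?R fst (weak_grad ?R fst)" by (rule has_weak_gradient_weak_grad[OF g])
  from weak_gradient_unique_box[OF g this]
  have "AE p in lebesgue_on ?R. (norm ((1, 0) - weak_grad ?R fst p))\<^sup>2 = 0"
    by eventually_elim simp
  then have "(LINT p|lebesgue_on ?R. (fst p - fst p)\<^sup>2 + (norm ((1, 0) - weak_grad ?R fst p))\<^sup>2) = 0"
    by (intro integral_eq_zero_AE) auto
  then have "(\<lambda>n::nat. LINT p|lebesgue_on ?R. (fst p - fst p)\<^sup>2 + (norm ((1, 0) - weak_grad ?R fst p))\<^sup>2) \<longlonglongrightarrow> 0"
    by simp
  moreover have "L2 {a<..<b} (\<lambda>x. x)"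
  proof -
    have "integrable (lebesgue_on (cbox a b)) (\<lambda>x. (norm x)\<^sup>2)"
      by (intro continuous_imp_integrable continuous_intros)
    then have "integrable (lebesgue_on {a<..<b}) (\<lambda>x. (norm x)\<^sup>2)"
      by (rule integrable_lebesgue_on_subset) auto
    then show ?thesis by (auto simp: L2_def intro!: borel_measurable_continuous_lebesgue_on continuous_intros)
  qed
  moreover have "(\<lambda>n::nat. LINT x|lebesgue_on {a<..<b}. (fst (x, 0::real) - x)\<^sup>2) \<longlonglongrightarrow> 0" by simp
  ultimately show ?thesis
    unfolding bottom_trace_def Let_def box_eq_rectangle
    using C1_fun_fst by (intro conjI exI[of _ "\<lambda>_. fst"] exI[of _ "\<lambda>_ _. (1, 0)"]) auto
qed

section \<open>Extension across the bottom by zero\<close>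

lemma integrable_continuous_compact_support:
  fixes F :: "'a::euclidean_space \<Rightarrow> 'b::euclidean_space"
  assumes "\<Omega> \<in> sets lebesgue" "continuous_on UNIV F" "compact K" "\<And>p. p \<in> \<Omega> \<Longrightarrow> p \<notin> K \<Longrightarrow> F p = 0"
  shows "integrable (lebesgue_on \<Omega>) F"
proof -
  have K: "K \<in> lmeasurable" using assms(3) by (simp add: lmeasurable_compact)
  have "integrable lebesgue (indicat_real K)" using K by (simp add: lmeasurable_iff_integrable)
  then have "integrable (lebesgue_on UNIV) (indicat_real K)" by (simp add: lebesgue_on_UNIV_eq)
  then have "integrable (lebesgue_on \<Omega>) (indicat_real K)"
    by (rule integrable_lebesgue_on_subset) (use assms(1) in auto)
  moreover have "(\<lambda>p. (norm (indicat_real K p))\<^sup>2) = indicat_real K" by (auto simp: indicator_def)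
  ultimately have "L2 \<Omega> (indicat_real K)" by (simp add: L2_def borel_measurable_integrable)
  from integrable_L2_scaleR_continuous[OF assms(1) this assms(2,3,4)]
  have "integrable (lebesgue_on \<Omega>) (\<lambda>p. indicat_real K p *\<^sub>R F p)" by simp
  moreover have "integrable (lebesgue_on \<Omega>) (\<lambda>p. indicat_real K p *\<^sub>R F p) \<longleftrightarrow> integrable (lebesgue_on \<Omega>) F"
    by (rule Bochner_Integration.integrable_cong) (use assms(4) in \<open>auto simp: indicator_def\<close>)
  ultimately show ?thesis by blast
qed

lemma test_fun_outside: "test_fun \<Omega> \<phi> D\<phi> \<Longrightarrow> p \<notin> \<Omega> \<Longrightarrow> \<phi> p = 0 \<and> D\<phi> p = 0"
  using test_fun_grad_0[of \<Omega> \<phi> D\<phi> p] tsupp_eq_0[of p \<phi>] by (auto simp: test_fun_def)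

text \<open>A test function has compact support, so Green's formula in a large square applies, whatever the
  shape of \<open>\<Omega>\<close> is.\<close>

lemma weak_gradient_fst:
  fixes \<phi> :: "real \<times> real \<Rightarrow> real"
  assumes \<Omega>: "\<Omega> \<in> sets lebesgue" and t: "test_fun \<Omega> \<phi> D\<phi>"
  shows "(LINT p|lebesgue_on \<Omega>. fst p *\<^sub>R D\<phi> p) = - (LINT p|lebesgue_on \<Omega>. \<phi> p *\<^sub>R (1, 0))"
proof -
  have C1: "C1_fun \<phi> D\<phi>" and comp: "compact (tsupp \<phi>)" using t by (auto simp: test_fun_def)
  obtain M where M: "\<And>p. p \<in> tsupp \<phi> \<Longrightarrow> norm p \<le> M" using compact_imp_bounded[OF comp] bounded_iff by blast
  define N where "N = \<bar>M\<bar> + 1"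
  define B where "B = box (-N, -N) (N, N)"
  have N: "N > 0" by (simp add: N_def)
  have inB: "p \<in> B" if "p \<in> tsupp \<phi>" for p
  proof -
    have "\<bar>fst p\<bar> \<le> M" "\<bar>snd p\<bar> \<le> M" using M[OF that] norm_fst_le[of "fst p" "snd p"] norm_snd_le[of "snd p" "fst p"] by auto
    then show ?thesis unfolding B_def mem_box_prod_real N_def by auto
  qed
  have z: "\<phi> p = 0 \<and> D\<phi> p = 0" if "p \<notin> \<Omega> \<inter> B" for p
    using that test_fun_outside[OF t, of p] inB[of p] test_fun_grad_0[OF t, of p] tsupp_eq_0[of p \<phi>] by blast
  have eq: "(LINT p|lebesgue_on \<Omega>. F p) = (LINT p|lebesgue_on B. F p)"
    if "\<And>p. p \<notin> \<Omega> \<inter> B \<Longrightarrow> F p = 0" for F :: "real \<times> real \<Rightarrow> real \<times> real"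
  proof -
    have "(LINT p|lebesgue_on (\<Omega> \<union> B). F p) = (LINT p|lebesgue_on \<Omega>. F p)"
      by (rule lebesgue_integral_on_subset) (use that \<Omega> in \<open>auto simp: B_def\<close>)
    moreover have "(LINT p|lebesgue_on (\<Omega> \<union> B). F p) = (LINT p|lebesgue_on B. F p)"
      by (rule lebesgue_integral_on_subset) (use that \<Omega> in \<open>auto simp: B_def\<close>)
    ultimately show ?thesis by simp
  qed
  have c: "continuous_on UNIV \<phi>" "continuous_on UNIV D\<phi>"
    using C1 by (auto intro: C1_fun_continuous C1_fun_grad_continuous)
  have bd: "p \<notin> B \<Longrightarrow> \<phi> p = 0" for p using z by blast
  have "(LINT p|lebesgue_on B. fst p *\<^sub>R D\<phi> p + \<phi> p *\<^sub>R (1, 0)) =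
      (0, - (LINT x|lebesgue_on {-N<..<N}. fst (x, -N) * \<phi> (x, -N)))"
    unfolding B_def
    by (rule integral_gradient_rectangle[OF C1_fun_mult[OF C1_fun_fst C1]])
       (use N in \<open>auto intro!: bd simp: B_def mem_box_prod_real\<close>)
  also have "\<dots> = 0"
    using bd[of "(x, -N)" for x] by (simp add: B_def mem_box_prod_real zero_prod_def)
  also have "(LINT p|lebesgue_on B. fst p *\<^sub>R D\<phi> p + \<phi> p *\<^sub>R (1, 0)) =
      (LINT p|lebesgue_on B. fst p *\<^sub>R D\<phi> p) + (LINT p|lebesgue_on B. \<phi> p *\<^sub>R (1, 0))"
    unfolding B_def
    by (intro Bochner_Integration.integral_add integrable_continuous_rectangle continuous_intros c)
  finally have "(LINT p|lebesgue_on B. fst p *\<^sub>R D\<phi> p) = - (LINT p|lebesgue_on B. \<phi> p *\<^sub>R (1, 0))"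
    by (simp add: add_eq_0_iff2)
  then show ?thesis
    using eq[of "\<lambda>p. fst p *\<^sub>R D\<phi> p"] eq[of "\<lambda>p. \<phi> p *\<^sub>R (1, 0)"] z by (simp add: zero_prod_def)
qed

text \<open>Test functions for the film that need not vanish at the bottom: in the upper half-plane the support
  lies in \<open>K\<close>, below it is arbitrary. When \<open>K\<close> is compact and lies strictly below the graph of \<open>h\<close>, such a
  function still vanishes near the free boundary.\<close>

definition boundary_test :: "(real \<times> real) set \<Rightarrow> (real \<times> real \<Rightarrow> real) \<Rightarrow> (real \<times> real \<Rightarrow> real \<times> real) \<Rightarrow> bool" where
  "boundary_test K \<phi> D\<phi> \<longleftrightarrow> C1_fun \<phi> D\<phi> \<and> (\<forall>p. 0 \<le> snd p \<longrightarrow> \<phi> p \<noteq> 0 \<longrightarrow> p \<in> K)"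

text \<open>This is the statement that \<open>w\<close> and \<open>q\<close>, continued by zero across the bottom of \<open>\<Omega>\<close>, satisfy the
  integration by parts formula of a function and its weak gradient for the test function \<open>\<phi>\<close>.\<close>

definition extends_by_zero where
  "extends_by_zero \<Omega> w q \<phi> D\<phi> \<longleftrightarrow>
     (LINT p|lebesgue_on \<Omega>. w p *\<^sub>R D\<phi> p) = - (LINT p|lebesgue_on \<Omega>. \<phi> p *\<^sub>R q p)"

text \<open>Lower semicontinuity provides a rectangle around each point of the subgraph.\<close>

lemma open_subgraph:
  assumes "lower_semicont h" shows "open (subgraph h)"
proof -
  have "\<exists>T. open T \<and> p \<in> T \<and> T \<subseteq> subgraph h" if "p \<in> subgraph h" for p
  proof -
    obtain x y where p: "p = (x, y)" by (cases p)
    then have y: "0 < y" "y < h x" using that by (auto simp: subgraph_def)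
    then obtain y' where y': "y < y'" "y' < h x" using dense by blast
    then have "\<forall>\<^sub>F z in nhds x. y' < h z" using assms by (auto simp: lower_semicont_def)
    then obtain S where S: "open S" "x \<in> S" "\<forall>z\<in>S. y' < h z" unfolding eventually_nhds by blast
    have "open (S \<times> {0<..<y'})" using S by (intro open_Times) auto
    moreover have "p \<in> S \<times> {0<..<y'}" using S y y' p by auto
    moreover have "S \<times> {0<..<y'} \<subseteq> subgraph h" using S by (force simp: subgraph_def)
    ultimately show ?thesis by blast
  qed
  then show ?thesis using open_subopen[of "subgraph h"] by blast
qed

lemma open_imp_lebesgue: "open S \<Longrightarrow> S \<in> sets lebesgue"
  by (simp add: borel_open sets_completionI_sets)

text \<open>The difference of \<open>u\<close> and \<open>(x,y) \<mapsto> x\<close> has zero trace at the bottom, so it should extend by zero.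
  The traces are given only on rectangles inside the film, which makes a localisation necessary.\<close>

context
  fixes h :: "real \<Rightarrow> real" and \<Omega> and u g K
  assumes lsc: "lower_semicont h" and \<Omega>: "\<Omega> = subgraph h"
    and u: "L2 \<Omega> u" "has_weak_gradient \<Omega> u g"
    and tr: "trace_eq_on h u (\<lambda>x. x) (tsupp h)"
    and K: "compact K" "K \<subseteq> {p. snd p < h (fst p)}"
begin

lemma subgraph_meas: "open \<Omega>" "\<Omega> \<in> sets lebesgue"
  using open_subgraph[OF lsc] open_imp_lebesgue \<Omega> by auto

lemma boundary_test_zero:
  assumes "boundary_test K \<phi> D\<phi>" "p \<in> \<Omega>" "p \<notin> K"
  shows "\<phi> p = 0" "D\<phi> p = 0"
proof -
  have z: "\<phi> p = 0" if "p \<in> \<Omega> - K" for p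
  proof -
    have "0 \<le> snd p" using that by (auto simp: \<Omega> subgraph_def)
    then show ?thesis using assms(1) that unfolding boundary_test_def by blast
  qed
  show "\<phi> p = 0" using z assms by blast
  have "open (\<Omega> - K)" using subgraph_meas K by (intro open_Diff compact_imp_closed)
  then show "D\<phi> p = 0"
    using C1_fun_eq_0_imp_grad_0[of \<phi> D\<phi> "\<Omega> - K" p] assms z by (auto simp: boundary_test_def)
qed

lemma boundary_test_continuous:
  assumes "boundary_test K \<phi> D\<phi>" shows "continuous_on UNIV \<phi>" "continuous_on UNIV D\<phi>"
  using assms by (auto simp: boundary_test_def intro: C1_fun_continuous C1_fun_grad_continuous)

lemma boundary_test_integrable:
  assumes t: "boundary_test K \<phi> D\<phi>"
  shows "integrable (lebesgue_on \<Omega>) (\<lambda>p. u p *\<^sub>R D\<phi> p)"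
    "integrable (lebesgue_on \<Omega>) (\<lambda>p. fst p *\<^sub>R D\<phi> p)"
    "integrable (lebesgue_on \<Omega>) (\<lambda>p. \<phi> p *\<^sub>R g p)"
    "integrable (lebesgue_on \<Omega>) (\<lambda>p. \<phi> p *\<^sub>R (1::real, 0::real))"
    "integrable (lebesgue_on \<Omega>) (\<lambda>p. (u p - fst p) *\<^sub>R D\<phi> p)"
    "integrable (lebesgue_on \<Omega>) (\<lambda>p. \<phi> p *\<^sub>R (g p - (1, 0)))"
proof -
  note c = boundary_test_continuous[OF t] and z = boundary_test_zero[OF t]
  have gL2: "L2 \<Omega> g" using u(2) by (simp add: has_weak_gradient_def)
  show 1: "integrable (lebesgue_on \<Omega>) (\<lambda>p. u p *\<^sub>R D\<phi> p)"
    by (rule integrable_L2_scaleR_continuous[OF subgraph_meas(2) u(1) c(2) K(1) z(2)])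
  show 2: "integrable (lebesgue_on \<Omega>) (\<lambda>p. fst p *\<^sub>R D\<phi> p)"
    by (rule integrable_continuous_compact_support[OF subgraph_meas(2) _ K(1)])
       (use c z in \<open>auto intro!: continuous_intros\<close>)
  show 3: "integrable (lebesgue_on \<Omega>) (\<lambda>p. \<phi> p *\<^sub>R g p)"
    by (rule integrable_continuous_scaleR_L2[OF subgraph_meas(2) gL2 c(1) K(1) z(1)])
  show 4: "integrable (lebesgue_on \<Omega>) (\<lambda>p. \<phi> p *\<^sub>R (1::real, 0::real))"
    by (rule integrable_continuous_compact_support[OF subgraph_meas(2) _ K(1)])
       (use c z in \<open>auto intro!: continuous_intros simp: zero_prod_def\<close>)
  show "integrable (lebesgue_on \<Omega>) (\<lambda>p. (u p - fst p) *\<^sub>R D\<phi> p)"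
    unfolding scaleR_diff_left by (rule Bochner_Integration.integrable_diff[OF 1 2])
  show "integrable (lebesgue_on \<Omega>) (\<lambda>p. \<phi> p *\<^sub>R (g p - (1, 0)))"
    unfolding scaleR_diff_right by (rule Bochner_Integration.integrable_diff[OF 3 4])
qed

abbreviation "extends \<equiv> extends_by_zero \<Omega> (\<lambda>p. u p - fst p) (\<lambda>p. g p - (1, 0))"

lemma extends_iff:
  assumes t: "boundary_test K \<phi> D\<phi>"
  shows "extends \<phi> D\<phi> \<longleftrightarrow>
    (LINT p|lebesgue_on \<Omega>. u p *\<^sub>R D\<phi> p) + (LINT p|lebesgue_on \<Omega>. \<phi> p *\<^sub>R g p) =
    (LINT p|lebesgue_on \<Omega>. fst p *\<^sub>R D\<phi> p) + (LINT p|lebesgue_on \<Omega>. \<phi> p *\<^sub>R (1, 0))"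
  using boundary_test_integrable(1-4)[OF t]
  by (simp add: extends_by_zero_def scaleR_diff_left scaleR_diff_right algebra_simps)

lemma extends_test_fun:
  assumes "boundary_test K \<phi> D\<phi>" "test_fun \<Omega> \<phi> D\<phi>"
  shows "extends \<phi> D\<phi>"
proof -
  have "(LINT p|lebesgue_on \<Omega>. u p *\<^sub>R D\<phi> p) = - (LINT p|lebesgue_on \<Omega>. \<phi> p *\<^sub>R g p)"
    using u(2) assms(2) unfolding has_weak_gradient_def by blast
  moreover have "(LINT p|lebesgue_on \<Omega>. fst p *\<^sub>R D\<phi> p) = - (LINT p|lebesgue_on \<Omega>. \<phi> p *\<^sub>R (1, 0))"
    by (rule weak_gradient_fst[OF subgraph_meas(2) assms(2)])
  ultimately show ?thesis unfolding extends_iff[OF assms(1)] by simp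
qed

lemma boundary_test_mult:
  assumes "boundary_test K \<phi> D\<phi>" "C1_fun \<zeta> G"
  shows "boundary_test K (\<lambda>p. \<phi> p * \<zeta> p) (\<lambda>p. \<phi> p *\<^sub>R G p + \<zeta> p *\<^sub>R D\<phi> p)"
  using assms C1_fun_mult unfolding boundary_test_def by auto

text \<open>The formula is additive in the test function; a cut-off splits it into two pieces with smaller
  supports.\<close>

lemma extends_split:
  assumes t: "boundary_test K \<phi> D\<phi>" and \<zeta>: "C1_fun \<zeta> G"
    and 1: "\<And>D. boundary_test K (\<lambda>p. \<phi> p * \<zeta> p) D \<Longrightarrow> extends (\<lambda>p. \<phi> p * \<zeta> p) D"
    and 2: "\<And>D. boundary_test K (\<lambda>p. \<phi> p * (1 - \<zeta> p)) D \<Longrightarrow> extends (\<lambda>p. \<phi> p * (1 - \<zeta> p)) D"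
  shows "extends \<phi> D\<phi>"
proof -
  have \<zeta>': "C1_fun (\<lambda>p. 1 - \<zeta> p) (\<lambda>p. - G p)"
  proof -
    have "((\<lambda>s. 1 - s) has_real_derivative -1) (at s)" for s :: real by (auto intro!: derivative_eq_intros)
    from C1_fun_compose[OF \<zeta> this] show ?thesis by simp
  qed
  note t1 = boundary_test_mult[OF t \<zeta>] and t2 = boundary_test_mult[OF t \<zeta>']
  have L: "(LINT p|lebesgue_on \<Omega>. (u p - fst p) *\<^sub>R D\<phi> p) =
      (LINT p|lebesgue_on \<Omega>. (u p - fst p) *\<^sub>R (\<phi> p *\<^sub>R G p + \<zeta> p *\<^sub>R D\<phi> p)) +
      (LINT p|lebesgue_on \<Omega>. (u p - fst p) *\<^sub>R (\<phi> p *\<^sub>R - G p + (1 - \<zeta> p) *\<^sub>R D\<phi> p))"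
    unfolding Bochner_Integration.integral_add[OF boundary_test_integrable(5)[OF t1] boundary_test_integrable(5)[OF t2], symmetric]
    by (simp flip: scaleR_add_right add: algebra_simps)
  have R: "(LINT p|lebesgue_on \<Omega>. \<phi> p *\<^sub>R (g p - (1, 0))) =
      (LINT p|lebesgue_on \<Omega>. (\<phi> p * \<zeta> p) *\<^sub>R (g p - (1, 0))) +
      (LINT p|lebesgue_on \<Omega>. (\<phi> p * (1 - \<zeta> p)) *\<^sub>R (g p - (1, 0)))"
  proof -
    have split: "(a * z) *\<^sub>R X + (a * (1 - z)) *\<^sub>R X = a *\<^sub>R X" for a z and X :: "real \<times> real"
      by (simp add: right_diff_distrib scaleR_diff_left)
    show ?thesis
      unfolding Bochner_Integration.integral_add[OF boundary_test_integrable(6)[OF t1] boundary_test_integrable(6)[OF t2], symmetric]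
        split ..
  qed
  show ?thesis
    using 1[OF t1] 2[OF t2] unfolding extends_by_zero_def L R by simp
qed

text \<open>A cut-off in the vertical direction separates two pieces. The upper piece is an ordinary test
  function of the film. The lower piece lives in a rectangle that reaches down to the bottom, where Green's
  formula with the trace applies both to \<open>u\<close> and to \<open>(x,y) \<mapsto> x\<close>; the boundary terms agree.\<close>

lemma extends_rectangle:
  assumes ab: "a < a'" "a' \<le> b'" "b' < b" "0 < c" and sub: "\<And>x. a < x \<Longrightarrow> x < b \<Longrightarrow> c < h x"
    and t: "boundary_test K \<phi> D\<phi>"
    and supp: "\<And>p. 0 \<le> snd p \<Longrightarrow> \<phi> p \<noteq> 0 \<Longrightarrow> a' \<le> fst p \<and> fst p \<le> b'"
  shows "extends \<phi> D\<phi>"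
proof -
  obtain G where "C1_fun (\<lambda>p::real \<times> real. smooth_step (3 / c * snd p + (-1))) G"
    by (rule C1_fun_step[OF C1_fun_snd])
  moreover define \<zeta> where "\<zeta> = (\<lambda>p::real \<times> real. smooth_step (3 / c * snd p + (-1)))"
  ultimately have C1\<zeta>: "C1_fun \<zeta> G" by simp
  have \<zeta>0: "\<zeta> p = 0" if "snd p \<le> c / 3" for p
    unfolding \<zeta>_def using that ab by (intro smooth_step_eq_0) (simp add: field_simps)
  have \<zeta>1: "\<zeta> p = 1" if "snd p \<ge> 2 * c / 3" for p
    unfolding \<zeta>_def using that ab by (intro smooth_step_eq_1) (simp add: field_simps)
  show ?thesis
  proof (rule extends_split[OF t C1\<zeta>])
    fix D assume D: "boundary_test K (\<lambda>p. \<phi> p * \<zeta> p) D"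
    define S where "S = K \<inter> {p. c / 3 \<le> snd p}"
    have cl: "closed {p::real \<times> real. c / 3 \<le> snd p}" by (intro closed_Collect_le continuous_intros)
    have S: "compact S" unfolding S_def by (rule compact_Int_closed[OF K(1) cl])
    have "{p. \<phi> p * \<zeta> p \<noteq> 0} \<subseteq> S"
    proof
      fix p assume p: "p \<in> {p. \<phi> p * \<zeta> p \<noteq> 0}"
      then have "c / 3 \<le> snd p" using \<zeta>0[of p] by (cases "snd p \<le> c / 3") auto
      moreover have "p \<in> K"
      proof -
        have "0 \<le> snd p" "\<phi> p \<noteq> 0" using \<open>c / 3 \<le> snd p\<close> ab p by auto
        then show ?thesis using t unfolding boundary_test_def by blast
      qed
      ultimately show "p \<in> S" by (simp add: S_def)
    qed
    then have sub: "tsupp (\<lambda>p. \<phi> p * \<zeta> p) \<subseteq> S"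
      unfolding tsupp_def using S by (intro closure_minimal compact_imp_closed)
    moreover have "compact (tsupp (\<lambda>p. \<phi> p * \<zeta> p))"
      using compact_Int_closed[OF S, of "tsupp (\<lambda>p. \<phi> p * \<zeta> p)"] sub
      by (metis Int_absorb1 closed_closure tsupp_def)
    moreover have "S \<subseteq> \<Omega>" using K(2) ab by (force simp: S_def \<Omega> subgraph_def)
    ultimately have "test_fun \<Omega> (\<lambda>p. \<phi> p * \<zeta> p) D"
      using D by (auto simp: test_fun_def boundary_test_def)
    then show "extends (\<lambda>p. \<phi> p * \<zeta> p) D" by (rule extends_test_fun[OF D])
  next
    define \<psi> where "\<psi> = (\<lambda>p. \<phi> p * (1 - \<zeta> p))"
    fix D assume D: "boundary_test K (\<lambda>p. \<phi> p * (1 - \<zeta> p)) D"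
    then have D: "boundary_test K \<psi> D" and C1: "C1_fun \<psi> D" by (simp_all add: \<psi>_def boundary_test_def)
    define R where "R = box (a, 0) (b, c)"
    \<comment> \<open>In the upper half-plane this closed strip contains the support of the lower piece; it meets the film only inside \<open>R\<close>, so the integrals over the film reduce to \<open>R\<close>.\<close>
    define S where "S = {p::real \<times> real. a' \<le> fst p \<and> fst p \<le> b' \<and> snd p \<le> 2 * c / 3}"
    have clS: "closed S" unfolding S_def by (intro closed_Collect_conj closed_Collect_le continuous_intros)
    have \<psi>S: "p \<in> S" if "0 \<le> snd p" "\<psi> p \<noteq> 0" for p
      using that supp[of p] \<zeta>1[of p] by (cases "snd p \<ge> 2 * c / 3") (auto simp: \<psi>_def S_def)
    have "a < b" using ab by linarith
    have R\<Omega>: "R \<subseteq> \<Omega>" using sub by (force simp: R_def box_eq_rectangle \<Omega> subgraph_def)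
    have Rm: "R \<in> sets lebesgue" "open R" by (auto simp: R_def)
    have z: "\<psi> p = 0" "D p = 0" if "p \<in> \<Omega> - R" for p
    proof -
      have o: "open (\<Omega> - S)" using subgraph_meas clS by blast
      have "0 < snd p" using that by (auto simp: \<Omega> subgraph_def)
      then have "p \<notin> S" using that ab by (auto simp: R_def mem_box_prod_real S_def)
      moreover have "\<psi> q = 0" if "q \<in> \<Omega> - S" for q
      proof -
        have "0 \<le> snd q" using that by (auto simp: \<Omega> subgraph_def)
        then show ?thesis using \<psi>S[of q] that by blast
      qed
      ultimately show "\<psi> p = 0" "D p = 0"
        using C1_fun_eq_0_imp_grad_0[OF C1 o] that by auto
    qed
    have sets: "{a<..<b} \<times> {0<..<c} \<subseteq> subgraph h" using R\<Omega> by (simp add: R_def box_eq_rectangle \<Omega>)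
    then obtain T where T: "bottom_trace a b c u T"
      and Tx: "AE x in lebesgue_on {a<..<b}. x \<in> tsupp h \<longrightarrow> T x = x"
      using tr \<open>a < b\<close> ab(4) unfolding trace_eq_on_def by blast
    have Tx': "AE x in lebesgue_on {a<..<b}. T x = x"
      using Tx AE_space
    proof eventually_elim
      case (elim x)
      then have "h x \<noteq> 0" using sub[of x] ab by auto
      then have "x \<in> tsupp h" using closure_subset[of "{x. h x \<noteq> 0}"] by (auto simp: tsupp_def)
      then show ?case using elim by simp
    qed
    have side: "\<psi> (a, y) = 0" "\<psi> (b, y) = 0" if "y \<in> {0..c}" for y
      using \<psi>S[of "(a, y)"] \<psi>S[of "(b, y)"] that ab by (auto simp: S_def)
    have top: "\<psi> (x, c) = 0" for x using \<zeta>1[of "(x, c)"] ab by (simp add: \<psi>_def)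
    have uR: "L2 R u" by (rule L2_subset[OF u(1) R\<Omega> Rm(1) subgraph_meas(2)])
    have gR: "has_weak_gradient R u g"
      by (rule has_weak_gradient_subset[OF u(2) R\<Omega> Rm(2) subgraph_meas(1)])
    have "(LINT p|lebesgue_on R. u p *\<^sub>R D p) + (LINT p|lebesgue_on R. \<psi> p *\<^sub>R g p)
       = (0, - (LINT x|lebesgue_on {a<..<b}. T x * \<psi> (x, 0)))"
      using bottom_trace_integral[OF \<open>a < b\<close> ab(4) uR[unfolded R_def] gR[unfolded R_def] T C1]
        side top by (simp add: R_def)
    also have "(LINT x|lebesgue_on {a<..<b}. T x * \<psi> (x, 0)) = (LINT x|lebesgue_on {a<..<b}. x * \<psi> (x, 0))"
    proof (rule integral_cong_AE)
      have c0: "continuous_on UNIV (\<lambda>x. \<psi> (x, 0))"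
        by (rule continuous_on_compose2[OF C1_fun_continuous[OF C1, of UNIV]]) (auto intro!: continuous_intros)
      then show "(\<lambda>x. x * \<psi> (x, 0)) \<in> borel_measurable (lebesgue_on {a<..<b})"
        by (intro borel_measurable_continuous_lebesgue_on continuous_intros) auto
      have "L2 {a<..<b} T" using T by (simp add: bottom_trace_def Let_def)
      then show "(\<lambda>x. T x * \<psi> (x, 0)) \<in> borel_measurable (lebesgue_on {a<..<b})"
        by (intro borel_measurable_times borel_measurable_continuous_lebesgue_on[OF c0]) (auto simp: L2_def)
      show "AE x in lebesgue_on {a<..<b}. T x * \<psi> (x, 0) = x * \<psi> (x, 0)"
        using Tx' by eventually_elim simp
    qed
    also have "(0, - (LINT x|lebesgue_on {a<..<b}. x * \<psi> (x, 0))) =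
        (LINT p|lebesgue_on R. fst p *\<^sub>R D p + \<psi> p *\<^sub>R (1, 0))"
      using integral_gradient_rectangle[OF C1_fun_mult[OF C1_fun_fst C1] \<open>a < b\<close> ab(4)] side top
      by (simp add: R_def)
    also have "\<dots> = (LINT p|lebesgue_on R. fst p *\<^sub>R D p) + (LINT p|lebesgue_on R. \<psi> p *\<^sub>R (1, 0))"
      unfolding R_def using boundary_test_continuous[OF D]
      by (intro Bochner_Integration.integral_add integrable_continuous_rectangle continuous_intros)
    finally have R: "(LINT p|lebesgue_on R. u p *\<^sub>R D p) + (LINT p|lebesgue_on R. \<psi> p *\<^sub>R g p)
       = (LINT p|lebesgue_on R. fst p *\<^sub>R D p) + (LINT p|lebesgue_on R. \<psi> p *\<^sub>R (1, 0))" .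
    note eq = lebesgue_integral_on_subset[OF R\<Omega> Rm(1) subgraph_meas(2)]
    have "extends \<psi> D"
      unfolding extends_iff[OF D]
      using R eq[of "\<lambda>p. u p *\<^sub>R D p"] eq[of "\<lambda>p. \<psi> p *\<^sub>R g p"] eq[of "\<lambda>p. fst p *\<^sub>R D p"]
        eq[of "\<lambda>p. \<psi> p *\<^sub>R (1::real, 0::real)"] z by (simp add: zero_prod_def)
    then show "extends (\<lambda>p. \<phi> p * (1 - \<zeta> p)) D" by (simp add: \<psi>_def)
  qed
qed

text \<open>Over a point with \<open>h x > 0\<close> there is a rectangle inside the film. Over a point with \<open>h x \<le> 0\<close> the
  set \<open>K\<close> has no point in the closed upper half-plane, and by compactness none nearby, so the test function
  vanishes in the film.\<close>

lemma extends_local: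
  obtains d where "d > 0" "\<And>\<phi> D\<phi>. boundary_test K \<phi> D\<phi> \<Longrightarrow>
    (\<And>p. 0 \<le> snd p \<Longrightarrow> \<phi> p \<noteq> 0 \<Longrightarrow> x - d \<le> fst p \<and> fst p \<le> x + d) \<Longrightarrow> extends \<phi> D\<phi>"
proof (cases "h x > 0")
  case True
  then have "h x / 2 < h x" by simp
  then have "\<forall>\<^sub>F y in nhds x. h x / 2 < h y" using lsc unfolding lower_semicont_def by blast
  then obtain e where e: "e > 0" "\<And>y. dist y x < e \<Longrightarrow> h x / 2 < h y"
    unfolding eventually_nhds_metric by blast
  have "extends \<phi> D\<phi>" if "boundary_test K \<phi> D\<phi>"
    "\<And>p. 0 \<le> snd p \<Longrightarrow> \<phi> p \<noteq> 0 \<Longrightarrow> x - e/2 \<le> fst p \<and> fst p \<le> x + e/2" for \<phi> D\<phi>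
    by (rule extends_rectangle[of "x - e" "x - e/2" "x + e/2" "x + e" "h x / 2", OF _ _ _ _ _ that])
       (use e True in \<open>auto simp: dist_real_def\<close>)
  then show ?thesis using that[of "e/2"] e(1) by auto
next
  case False
  define P where "P = fst ` (K \<inter> {p. 0 \<le> snd p})"
  have "closed {p::real \<times> real. 0 \<le> snd p}" by (intro closed_Collect_le continuous_intros)
  then have "compact P" unfolding P_def using K(1)
    by (intro compact_continuous_image compact_Int_closed continuous_intros)
  moreover have "x \<notin> P" using False K(2) by (force simp: P_def)
  ultimately obtain e where e: "e > 0" "\<And>y. dist y x < e \<Longrightarrow> y \<notin> P"
    using compact_imp_closed[of P] open_Compl[of P] unfolding open_dist by (metis ComplD ComplI)
  have "extends \<phi> D\<phi>" if t: "boundary_test K \<phi> D\<phi>"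
    and s: "\<And>p. 0 \<le> snd p \<Longrightarrow> \<phi> p \<noteq> 0 \<Longrightarrow> x - e/2 \<le> fst p \<and> fst p \<le> x + e/2" for \<phi> D\<phi>
  proof -
    have z: "\<phi> p = 0" if "p \<in> \<Omega>" for p
    proof (rule ccontr)
      assume nz: "\<phi> p \<noteq> 0"
      have p: "0 \<le> snd p" using that by (auto simp: \<Omega> subgraph_def)
      then have "p \<in> K" using t nz unfolding boundary_test_def by blast
      then have "fst p \<in> P" using p by (auto simp: P_def)
      moreover have "dist (fst p) x < e" using s[OF p nz] e(1) by (auto simp: dist_real_def)
      ultimately show False using e(2) by blast
    qed
    have "D\<phi> p = 0" if "p \<in> \<Omega>" for p
      using C1_fun_eq_0_imp_grad_0[OF _ subgraph_meas(1) z that] t by (auto simp: boundary_test_def)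
    then have "(LINT p|lebesgue_on \<Omega>. (u p - fst p) *\<^sub>R D\<phi> p) = 0"
      by (intro integral_eq_zero_AE AE_I2) simp
    moreover have "(LINT p|lebesgue_on \<Omega>. \<phi> p *\<^sub>R (g p - (1, 0))) = 0"
      by (intro integral_eq_zero_AE AE_I2) (simp add: z)
    ultimately show ?thesis by (simp add: extends_by_zero_def)
  qed
  then show ?thesis using that[of "e/2"] e(1) by auto
qed

text \<open>The local statement is made global along the \<open>x\<close>-axis by the bisection principle \<open>Bolzano\<close>:
  two adjacent intervals are joined by a cut-off that switches between them. Since this transition takes place
  beyond the common endpoint, the property of an interval allows for supports that exceed it by a margin
  \<open>\<eta>\<close>.\<close>

lemma extends_boundary_test:
  assumes t: "boundary_test K \<phi> D\<phi>"
  shows "extends \<phi> D\<phi>"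
proof -
  define P where "P \<alpha> \<beta> \<longleftrightarrow> (\<exists>\<eta>>0. \<forall>\<phi> D\<phi>. boundary_test K \<phi> D\<phi> \<longrightarrow>
    (\<forall>p. 0 \<le> snd p \<longrightarrow> \<phi> p \<noteq> 0 \<longrightarrow> \<alpha> - \<eta> \<le> fst p \<and> fst p \<le> \<beta> + \<eta>) \<longrightarrow> extends \<phi> D\<phi>)" for \<alpha> \<beta>
  obtain M where M: "\<And>p. p \<in> K \<Longrightarrow> norm p \<le> M" using compact_imp_bounded[OF K(1)] bounded_iff by blast
  have "P (-\<bar>M\<bar>) \<bar>M\<bar>"
  proof (rule Bolzano)
    show "- \<bar>M\<bar> \<le> \<bar>M\<bar>" by simp
  next
    fix a b c assume P: "P a b" "P b c" and abc: "a \<le> b" "b \<le> c"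
    obtain \<eta>1 where \<eta>1: "\<eta>1 > 0" and 1: "\<And>\<phi> D\<phi>. boundary_test K \<phi> D\<phi> \<Longrightarrow>
      (\<And>p. 0 \<le> snd p \<Longrightarrow> \<phi> p \<noteq> 0 \<Longrightarrow> a - \<eta>1 \<le> fst p \<and> fst p \<le> b + \<eta>1) \<Longrightarrow> extends \<phi> D\<phi>"
      using P(1) unfolding P_def by blast
    obtain \<eta>2 where \<eta>2: "\<eta>2 > 0" and 2: "\<And>\<phi> D\<phi>. boundary_test K \<phi> D\<phi> \<Longrightarrow>
      (\<And>p. 0 \<le> snd p \<Longrightarrow> \<phi> p \<noteq> 0 \<Longrightarrow> b - \<eta>2 \<le> fst p \<and> fst p \<le> c + \<eta>2) \<Longrightarrow> extends \<phi> D\<phi>"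
      using P(2) unfolding P_def by blast
    define \<eta> where "\<eta> = min \<eta>1 \<eta>2"
    have \<eta>: "\<eta> > 0" "\<eta> \<le> \<eta>1" "\<eta> \<le> \<eta>2" using \<eta>1 \<eta>2 by (auto simp: \<eta>_def)
    obtain G where "C1_fun (\<lambda>p::real \<times> real. smooth_step (1 / \<eta> * fst p + (- b / \<eta>))) G"
      by (rule C1_fun_step[OF C1_fun_fst])
    moreover define \<zeta> where "\<zeta> = (\<lambda>p::real \<times> real. smooth_step (1 / \<eta> * fst p + (- b / \<eta>)))"
    ultimately have C1\<zeta>: "C1_fun \<zeta> G" by simp
    have \<zeta>0: "\<zeta> p = 0" if "fst p \<le> b" for p
      unfolding \<zeta>_def using that \<eta> by (intro smooth_step_eq_0) (simp add: field_simps)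
    have \<zeta>1: "\<zeta> p = 1" if "fst p \<ge> b + \<eta>" for p
      unfolding \<zeta>_def using that \<eta> by (intro smooth_step_eq_1) (simp add: field_simps)
    have "extends \<phi> D\<phi>" if t: "boundary_test K \<phi> D\<phi>"
      and s: "\<And>p. 0 \<le> snd p \<Longrightarrow> \<phi> p \<noteq> 0 \<Longrightarrow> a - \<eta> \<le> fst p \<and> fst p \<le> c + \<eta>" for \<phi> D\<phi>
    proof (rule extends_split[OF t C1\<zeta>])
      fix D assume D: "boundary_test K (\<lambda>p. \<phi> p * \<zeta> p) D"
      show "extends (\<lambda>p. \<phi> p * \<zeta> p) D"
      proof (rule 2[OF D])
        fix p assume p: "0 \<le> snd p" "\<phi> p * \<zeta> p \<noteq> 0"
        then have "\<not> fst p \<le> b" using \<zeta>0[of p] by auto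
        then show "b - \<eta>2 \<le> fst p \<and> fst p \<le> c + \<eta>2" using s[OF p(1)] p(2) \<eta> \<eta>2 by auto
      qed
    next
      fix D assume D: "boundary_test K (\<lambda>p. \<phi> p * (1 - \<zeta> p)) D"
      show "extends (\<lambda>p. \<phi> p * (1 - \<zeta> p)) D"
      proof (rule 1[OF D])
        fix p assume p: "0 \<le> snd p" "\<phi> p * (1 - \<zeta> p) \<noteq> 0"
        then have "\<not> fst p \<ge> b + \<eta>" using \<zeta>1[of p] by auto
        then show "a - \<eta>1 \<le> fst p \<and> fst p \<le> b + \<eta>1" using s[OF p(1)] p(2) \<eta> \<eta>1 by auto
      qed
    qed
    then show "P a c" unfolding P_def using \<eta>(1) by blast
  next
    fix x
    obtain d where d: "d > 0" "\<And>\<phi> D\<phi>. boundary_test K \<phi> D\<phi> \<Longrightarrow>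
      (\<And>p. 0 \<le> snd p \<Longrightarrow> \<phi> p \<noteq> 0 \<Longrightarrow> x - d \<le> fst p \<and> fst p \<le> x + d) \<Longrightarrow> extends \<phi> D\<phi>"
      using extends_local[of x] by blast
    have "P a b" if ab: "a \<le> x" "x \<le> b" "b - a < d / 2" for a b
      unfolding P_def
    proof (intro exI[of _ "d/2"] conjI allI impI)
      fix \<phi> D\<phi> assume t: "boundary_test K \<phi> D\<phi>"
        and s: "\<forall>p. 0 \<le> snd p \<longrightarrow> \<phi> p \<noteq> 0 \<longrightarrow> a - d / 2 \<le> fst p \<and> fst p \<le> b + d / 2"
      show "extends \<phi> D\<phi>"
      proof (rule d(2)[OF t])
        fix p assume "0 \<le> snd p" "\<phi> p \<noteq> 0"
        then have "a - d / 2 \<le> fst p \<and> fst p \<le> b + d / 2" using s by blast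
        then show "x - d \<le> fst p \<and> fst p \<le> x + d" using ab by linarith
      qed
    qed (use d in auto)
    then show "\<exists>d>0. \<forall>a b. a \<le> x \<and> x \<le> b \<and> b - a < d \<longrightarrow> P a b"
      using d(1) by (intro exI[of _ "d/2"]) auto
  qed
  then obtain \<eta> where \<eta>: "\<eta> > 0" and *: "\<And>\<phi> D\<phi>. boundary_test K \<phi> D\<phi> \<Longrightarrow>
      (\<And>p. 0 \<le> snd p \<Longrightarrow> \<phi> p \<noteq> 0 \<Longrightarrow> -\<bar>M\<bar> - \<eta> \<le> fst p \<and> fst p \<le> \<bar>M\<bar> + \<eta>) \<Longrightarrow> extends \<phi> D\<phi>"
    unfolding P_def by blast
  show ?thesis
  proof (rule *[OF t])
    fix p assume "0 \<le> snd p" "\<phi> p \<noteq> 0"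
    then have "p \<in> K" using t unfolding boundary_test_def by blast
    then have "\<bar>fst p\<bar> \<le> M" using M[of p] norm_fst_le[of "fst p" "snd p"] by auto
    then show "-\<bar>M\<bar> - \<eta> \<le> fst p \<and> fst p \<le> \<bar>M\<bar> + \<eta>" using \<eta> by linarith
  qed
qed

end

section \<open>Variation and infimal convolution\<close>

definition list_variation :: "(real \<Rightarrow> real) \<Rightarrow> real list \<Rightarrow> real" where
  "list_variation h xs = (\<Sum>i = 1..<length xs. \<bar>h (xs ! i) - h (xs ! (i - 1))\<bar>)"

lemma pointwise_variation_eq:
  "pointwise_variation h = (SUP xs \<in> {xs. sorted_wrt (<) xs}. ereal (list_variation h xs))"
  unfolding pointwise_variation_def list_variation_def ..

lemma list_variation_snoc:
  "list_variation h (xs @ [a]) = list_variation h xs + (if xs = [] then 0 else \<bar>h a - h (last xs)\<bar>)"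
proof (cases "xs = []")
  case False
  then have "{1..<length (xs @ [a])} = insert (length xs) {1..<length xs}" by (cases xs) auto
  moreover have "(\<Sum>i = 1..<length xs. \<bar>h ((xs @ [a]) ! i) - h ((xs @ [a]) ! (i - 1))\<bar>)
      = (\<Sum>i = 1..<length xs. \<bar>h (xs ! i) - h (xs ! (i - 1))\<bar>)"
    by (rule sum.cong) (auto simp: nth_append)
  ultimately show ?thesis using False
    by (simp add: list_variation_def nth_append last_conv_nth)
qed (simp add: list_variation_def)

text \<open>The variation of \<open>h\<close> on \<open>(-\<infinity>, x]\<close>; it bounds oscillations of \<open>h\<close> by increments of a monotone
  function.\<close>

definition left_variation :: "(real \<Rightarrow> real) \<Rightarrow> real \<Rightarrow> real" where
  "left_variation h x = (SUP xs \<in> {xs. sorted_wrt (<) xs \<and> set xs \<subseteq> {..x}}. list_variation h xs)"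

context
  fixes h :: "real \<Rightarrow> real" and W :: real
  assumes W: "\<And>xs. sorted_wrt (<) xs \<Longrightarrow> list_variation h xs \<le> W"
begin

lemma left_variation_upper:
  "sorted_wrt (<) xs \<Longrightarrow> set xs \<subseteq> {..x} \<Longrightarrow> list_variation h xs \<le> left_variation h x"
  unfolding left_variation_def by (rule cSUP_upper) (use W in \<open>auto intro!: bdd_aboveI2\<close>)

lemma left_variation_bounds: "0 \<le> left_variation h x" "left_variation h x \<le> W"
proof -
  show "0 \<le> left_variation h x" using left_variation_upper[of "[]" x] by (simp add: list_variation_def)
  show "left_variation h x \<le> W"
    unfolding left_variation_def by (rule cSUP_least) (use W in \<open>auto intro: exI[of _ "[]"]\<close>)
qed

text \<open>A chain in \<open>(-\<infinity>, x]\<close> may be assumed to end at \<open>x\<close>, as adding a point does not decrease its variation;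
  it can then be continued by \<open>y\<close>.\<close>

lemma left_variation_increment:
  assumes "x \<le> y" shows "left_variation h x + \<bar>h y - h x\<bar> \<le> left_variation h y"
proof (cases "x = y")
  case False
  then have xy: "x < y" using assms by simp
  have "list_variation h xs \<le> left_variation h y - \<bar>h y - h x\<bar>"
    if xs: "sorted_wrt (<) xs" "set xs \<subseteq> {..x}" for xs
  proof -
    \<comment> \<open>The chain completed by \<open>x\<close>, unless it already ends there.\<close>
    define ys where "ys = (if xs \<noteq> [] \<and> last xs = x then xs else xs @ [x])"
    have lt: "z < x" if "\<not> (xs \<noteq> [] \<and> last xs = x)" "z \<in> set xs" for z
    proof -
      have ne: "xs \<noteq> []" using that by auto
      then obtain zs l where zs: "xs = zs @ [l]" by (metis rev_exhaust)
      then have "l < x" using that(1) xs(2) by auto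
      moreover have "z \<le> l" using that(2) xs(1) zs by (auto simp: sorted_wrt_append)
      ultimately show ?thesis by simp
    qed
    have ys: "sorted_wrt (<) ys" "set ys \<subseteq> {..x}" "ys \<noteq> []" "last ys = x"
      using xs lt by (auto simp: ys_def sorted_wrt_append)
    have "list_variation h xs \<le> list_variation h ys" by (simp add: ys_def list_variation_snoc)
    also have "list_variation h ys + \<bar>h y - h x\<bar> = list_variation h (ys @ [y])"
      using ys by (simp add: list_variation_snoc)
    then have "list_variation h ys = list_variation h (ys @ [y]) - \<bar>h y - h x\<bar>" by simp
    also have "list_variation h (ys @ [y]) \<le> left_variation h y"
    proof (rule left_variation_upper)
      show "sorted_wrt (<) (ys @ [y])" using ys xy by (force simp: sorted_wrt_append)
      show "set (ys @ [y]) \<subseteq> {..y}" using ys xy by force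
    qed
    finally show ?thesis by simp
  qed
  then have "left_variation h x \<le> left_variation h y - \<bar>h y - h x\<bar>"
    unfolding left_variation_def[of h x] by (intro cSUP_least) (auto intro: exI[of _ "[]"])
  then show ?thesis by simp
qed simp

lemma left_variation_mono: "mono (left_variation h)"
  by (rule monoI) (use left_variation_increment in force)

lemma oscillation_le_variation: "\<bar>h y - h x\<bar> \<le> W"
proof -
  have "\<bar>h y - h x\<bar> \<le> W" if "x \<le> y" for x y
    using left_variation_increment[OF that] left_variation_bounds[of x] left_variation_bounds[of y] by linarith
  from this[of x y] this[of y x] show ?thesis by (cases "x \<le> y") auto
qed

text \<open>Shifting a monotone function with values in \<open>[0, W]\<close> by \<open>2 r\<close> changes its integral over an
  interval only by contributions of two end pieces of length \<open>2 r\<close>. This replaces the use of Fubini's theorem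
  for the variation measure.\<close>

lemma integral_left_variation_shift:
  assumes "r \<ge> 0" "n \<ge> 0"
  shows "(\<lambda>x. left_variation h (x + r) - left_variation h (x - r)) integrable_on {-n..n}"
    and "integral {-n..n} (\<lambda>x. left_variation h (x + r) - left_variation h (x - r)) \<le> 2 * r * W"
proof -
  let ?v = "left_variation h"
  have int: "?v integrable_on {a..b}" for a b
    using integrable_mono_on[of a b ?v] left_variation_mono
    by (auto simp: mono_on_def mono_def intro: integrable_on_lebesgue_on)
  have shift: "((\<lambda>x. ?v (x + c)) has_integral integral {-n+c..n+c} ?v) {-n..n}" for c
    using has_integral_shift_cbox_iff[of ?v c "integral {-n+c..n+c} ?v" "-n" n]
      integrable_integral[OF int[of "-n+c" "n+c"]] by (simp add: o_def add.commute)
  from has_integral_diff[OF shift[of r] shift[of "-r"]]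
  have d: "((\<lambda>x. ?v (x + r) - ?v (x - r)) has_integral (integral {-n+r..n+r} ?v - integral {-n-r..n-r} ?v)) {-n..n}"
    by simp
  then show "(\<lambda>x. ?v (x + r) - ?v (x - r)) integrable_on {-n..n}" by blast
  have "integral {-n-r..-n+r} ?v + integral {-n+r..n+r} ?v = integral {-n-r..n+r} ?v"
    using assms by (intro Henstock_Kurzweil_Integration.integral_combine int) auto
  moreover have "integral {-n-r..n-r} ?v + integral {n-r..n+r} ?v = integral {-n-r..n+r} ?v"
    using assms by (intro Henstock_Kurzweil_Integration.integral_combine int) auto
  moreover have "integral {-n-r..-n+r} ?v \<ge> 0"
    by (rule integral_nonneg[OF int]) (use left_variation_bounds in auto)
  moreover have "integral {n-r..n+r} ?v \<le> integral {n-r..n+r} (\<lambda>_. W)"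
    by (rule integral_le[OF int]) (use left_variation_bounds in auto)
  ultimately show "integral {-n..n} (\<lambda>x. ?v (x + r) - ?v (x - r)) \<le> 2 * r * W"
    using integral_unique[OF d] assms by simp
qed

end

text \<open>The largest \<open>\<epsilon>\<close>-Lipschitz function below \<open>h\<close>.\<close>

definition inf_conv :: "real \<Rightarrow> (real \<Rightarrow> real) \<Rightarrow> real \<Rightarrow> real" where
  "inf_conv \<epsilon> h x = (INF z. h z + \<epsilon> * \<bar>x - z\<bar>)"

context
  fixes h :: "real \<Rightarrow> real" and \<epsilon> :: real
  assumes h: "\<And>x. 0 \<le> h x" and \<epsilon>: "\<epsilon> > 0"
begin

lemma inf_conv_le_shifted: "inf_conv \<epsilon> h x \<le> h z + \<epsilon> * \<bar>x - z\<bar>"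
  unfolding inf_conv_def by (rule cINF_lower) (use h \<epsilon> in \<open>auto intro!: bdd_belowI2[of _ 0]\<close>)

lemma inf_conv_le: "inf_conv \<epsilon> h x \<le> h x"
  using inf_conv_le_shifted[of x x] by simp

lemma inf_conv_lipschitz: "\<bar>inf_conv \<epsilon> h x - inf_conv \<epsilon> h y\<bar> \<le> \<epsilon> * \<bar>x - y\<bar>"
proof -
  have "inf_conv \<epsilon> h x - \<epsilon> * \<bar>x - y\<bar> \<le> inf_conv \<epsilon> h y" for x y
    unfolding inf_conv_def[of _ _ y]
  proof (rule cINF_greatest)
    fix z
    have "inf_conv \<epsilon> h x \<le> h z + \<epsilon> * \<bar>x - z\<bar>" by (rule inf_conv_le_shifted)
    also have "\<epsilon> * \<bar>x - z\<bar> \<le> \<epsilon> * (\<bar>x - y\<bar> + \<bar>y - z\<bar>)" using \<epsilon> by (intro mult_left_mono) auto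
    finally show "inf_conv \<epsilon> h x - \<epsilon> * \<bar>x - y\<bar> \<le> h z + \<epsilon> * \<bar>y - z\<bar>" by (simp add: distrib_left)
  qed simp
  from this[of x y] this[of y x] show ?thesis by (simp add: abs_minus_commute abs_le_iff)
qed

text \<open>Points \<open>z\<close> at distance more than \<open>W / \<epsilon>\<close> from \<open>x\<close> do not matter in the infimum, because their penalty
  exceeds the total oscillation \<open>W\<close>; the other ones lie in an interval on which the variation of \<open>h\<close> is
  bounded by the right-hand side.\<close>

lemma inf_conv_deficit:
  assumes W: "\<And>xs. sorted_wrt (<) xs \<Longrightarrow> list_variation h xs \<le> W"
  shows "h x - inf_conv \<epsilon> h x \<le> left_variation h (x + W / \<epsilon>) - left_variation h (x - W / \<epsilon>)"
proof -
  let ?v = "left_variation h" and ?r = "W / \<epsilon>"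
  have "W \<ge> 0" using W[of "[]"] by (simp add: list_variation_def)
  then have r: "?r \<ge> 0" using \<epsilon> by simp
  have m: "a \<le> b \<Longrightarrow> ?v a \<le> ?v b" for a b using left_variation_mono[OF W] by (auto simp: mono_def)
  have "h x - (?v (x + ?r) - ?v (x - ?r)) \<le> inf_conv \<epsilon> h x"
    unfolding inf_conv_def[of _ _ x]
  proof (rule cINF_greatest)
    fix z
    have sub: "\<bar>h x - h z\<bar> \<le> ?v (x + ?r) - ?v (x - ?r)" if "\<bar>x - z\<bar> \<le> ?r"
    proof (cases "x \<le> z")
      case True
      have "?v (x - ?r) \<le> ?v x" "?v z \<le> ?v (x + ?r)" using True that r by (auto intro!: m)
      then show ?thesis using left_variation_increment[OF W True] by linarith
    next
      case False
      then have "?v (x - ?r) \<le> ?v z" "?v x \<le> ?v (x + ?r)" using that r by (auto intro!: m)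
      moreover have "?v z + \<bar>h x - h z\<bar> \<le> ?v x" using False by (intro left_variation_increment[OF W]) auto
      ultimately show ?thesis by linarith
    qed
    show "h x - (?v (x + ?r) - ?v (x - ?r)) \<le> h z + \<epsilon> * \<bar>x - z\<bar>"
    proof (cases "\<bar>x - z\<bar> \<le> ?r")
      case True
      have "0 \<le> \<epsilon> * \<bar>x - z\<bar>" using \<epsilon> by simp
      then show ?thesis using sub[OF True] by linarith
    next
      case False
      then have "W \<le> \<epsilon> * \<bar>x - z\<bar>" using \<epsilon> by (simp add: not_le pos_divide_less_eq mult.commute)
      moreover have "\<bar>h x - h z\<bar> \<le> W" by (rule oscillation_le_variation[OF W])
      moreover have "0 \<le> ?v (x + ?r) - ?v (x - ?r)" using m[of "x - ?r" "x + ?r"] r by simp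
      ultimately show ?thesis by linarith
    qed
  qed simp
  then show ?thesis by linarith
qed

end

lemma lipschitz_continuous_on:
  fixes k :: "real \<Rightarrow> real"
  assumes "\<And>x y. \<bar>k x - k y\<bar> \<le> \<epsilon> * \<bar>x - y\<bar>"
  shows "continuous_on S k"
proof (rule continuous_on_subset[OF _ subset_UNIV], rule lipschitz_on_continuous_on)
  have "0 \<le> \<epsilon>" using assms[of 1 0] by simp
  then show "\<epsilon>-lipschitz_on UNIV k" using assms by (auto intro!: lipschitz_onI simp: dist_real_def)
qed

text \<open>The mean of \<open>k\<close> over \<open>[x, x + s]\<close> gains one derivative and keeps the Lipschitz constant.\<close>

lemma lipschitz_average:
  fixes k :: "real \<Rightarrow> real"
  assumes k: "\<And>x y. \<bar>k x - k y\<bar> \<le> \<epsilon> * \<bar>x - y\<bar>" and \<tau>: "\<tau> > 0"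
  obtains s S where "s > 0" "\<And>x. (S has_real_derivative (k (x + s) - k x) / s) (at x)"
    "\<And>x. \<bar>(k (x + s) - k x) / s\<bar> \<le> \<epsilon>" "\<And>x. \<bar>S x - k x\<bar> \<le> \<tau>"
proof -
  have \<epsilon>: "0 \<le> \<epsilon>" using k[of 1 0] by simp
  \<comment> \<open>The averages deviate from \<open>k\<close> by at most \<open>\<epsilon> s\<close>; the added \<open>1\<close> covers constant functions.\<close>
  define s where "s = \<tau> / (\<epsilon> + 1)"
  have s: "s > 0" "\<epsilon> * s \<le> \<tau>" using \<epsilon> \<tau> by (auto simp: s_def field_simps)
  have cont: "isCont k x" for x
    using lipschitz_continuous_on[OF k, of UNIV] by (simp add: continuous_on_eq_continuous_at)
  obtain P where P: "\<And>x. (P has_real_derivative k x) (at x)"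
    using einterval_antiderivative[of "-\<infinity>" "\<infinity>" k] cont
    by (auto simp: has_real_derivative_iff_has_vector_derivative)
  define S where "S x = (P (x + s) - P x) / s" for x
  have "(S has_real_derivative (k (x + s) - k x) / s) (at x)" for x
  proof -
    have "((\<lambda>x. x + s) has_real_derivative 1) (at x)" by (auto intro!: derivative_eq_intros)
    from DERIV_chain2[OF P this] have "((\<lambda>x. P (x + s)) has_real_derivative k (x + s)) (at x)" by simp
    from DERIV_cdivide[OF DERIV_diff[OF this P]] show ?thesis by (simp add: S_def[abs_def])
  qed
  moreover have "\<bar>(k (x + s) - k x) / s\<bar> \<le> \<epsilon>" for x
    using k[of "x + s" x] s by (simp add: pos_divide_le_eq abs_divide)
  moreover have "\<bar>S x - k x\<bar> \<le> \<tau>" for x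
  proof -
    obtain z where z: "x < z" "z < x + s" "P (x + s) - P x = (x + s - x) * k z"
      using MVT2[of x "x + s" P k] s P by auto
    then have "S x = k z" using s by (simp add: S_def)
    moreover have "\<bar>k z - k x\<bar> \<le> \<epsilon> * \<bar>z - x\<bar>" by (rule k)
    moreover have "\<epsilon> * \<bar>z - x\<bar> \<le> \<epsilon> * s" using z \<epsilon> by (intro mult_left_mono) auto
    ultimately show ?thesis using s by linarith
  qed
  ultimately show ?thesis using that s by blast
qed

text \<open>Two successive averages. Two derivatives are required since \<open>f'\<close> enters a test function of class C1.\<close>

lemma C2_approximation_of_lipschitz:
  fixes k :: "real \<Rightarrow> real"
  assumes k: "\<And>x y. \<bar>k x - k y\<bar> \<le> \<epsilon> * \<bar>x - y\<bar>" and \<tau>: "\<tau> > 0"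
  obtains f f' f'' where "\<And>x. (f has_real_derivative f' x) (at x)" "\<And>x. (f' has_real_derivative f'' x) (at x)"
    "continuous_on UNIV f''" "\<And>x. \<bar>f' x\<bar> \<le> \<epsilon>" "\<And>x. \<bar>f x - k x\<bar> \<le> \<tau>"
proof -
  obtain s S where S: "s > 0" "\<And>x. (S has_real_derivative (k (x + s) - k x) / s) (at x)"
    "\<And>x. \<bar>(k (x + s) - k x) / s\<bar> \<le> \<epsilon>" "\<And>x. \<bar>S x - k x\<bar> \<le> \<tau> / 2"
    using lipschitz_average[OF k, of "\<tau> / 2"] \<tau> by auto
  have lip: "\<bar>S x - S y\<bar> \<le> \<epsilon> * \<bar>x - y\<bar>" for x y
  proof -
    have "norm (S x - S y) \<le> \<epsilon> * norm (x - y)"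
      by (rule field_differentiable_bound[of UNIV S "\<lambda>x. (k (x + s) - k x) / s"])
         (use S in \<open>auto intro: has_field_derivative_at_within\<close>)
    then show ?thesis by simp
  qed
  have half: "\<tau> / 2 > 0" using \<tau> by simp
  obtain t f where f: "t > 0" "\<And>x. (f has_real_derivative (S (x + t) - S x) / t) (at x)"
    "\<And>x. \<bar>(S (x + t) - S x) / t\<bar> \<le> \<epsilon>" "\<And>x. \<bar>f x - S x\<bar> \<le> \<tau> / 2"
    using lipschitz_average[OF lip half] by blast
  define S' where "S' x = (k (x + s) - k x) / s" for x
  have cS': "continuous_on UNIV S'"
    unfolding S'_def[abs_def]
    using S(1) by (intro continuous_intros continuous_on_compose2[OF lipschitz_continuous_on[OF k, of UNIV]]
        lipschitz_continuous_on[OF k]) auto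
  have 1: "((\<lambda>x. (S (x + t) - S x) / t) has_real_derivative (S' (x + t) - S' x) / t) (at x)" for x
  proof -
    have "((\<lambda>x. x + t) has_real_derivative 1) (at x)" by (auto intro!: derivative_eq_intros)
    from DERIV_chain2[OF S(2) this] have "((\<lambda>x. S (x + t)) has_real_derivative S' (x + t)) (at x)"
      by (simp add: S'_def)
    from DERIV_cdivide[OF DERIV_diff[OF this S(2)]] show ?thesis by (simp add: S'_def)
  qed
  have 2: "continuous_on UNIV (\<lambda>x. (S' (x + t) - S' x) / t)"
    using f(1) by (intro continuous_intros cS' continuous_on_compose2[OF cS']) auto
  have 3: "\<bar>f x - k x\<bar> \<le> \<tau>" for x using f(4)[of x] S(4)[of x] by linarith
  show ?thesis by (rule that[OF f(2) 1 2 f(3) 3])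
qed

section \<open>The lower bound for the energy\<close>

lemma area_under_graph:
  fixes m :: "real \<Rightarrow> real"
  assumes m: "continuous_on UNIV m"
    and A: "A = {p. -n \<le> fst p \<and> fst p \<le> n \<and> 0 < snd p \<and> snd p < m (fst p)}"
  shows "A \<in> sets borel" "emeasure lborel A \<ge> ennreal (integral {-n..n} m)"
proof -
  have c: "continuous_on UNIV (\<lambda>p::real \<times> real. m (fst p))"
    by (rule continuous_on_compose2[OF m]) (auto intro!: continuous_intros)
  have "A = {p. -n \<le> fst p} \<inter> {p. fst p \<le> n} \<inter> {p. 0 < snd p} \<inter> {p. snd p < m (fst p)}"
    unfolding A by auto
  also have "\<dots> \<in> sets borel"
    by (intro sets.Int borel_closed borel_open closed_Collect_le open_Collect_less continuous_intros c)
  finally show borel: "A \<in> sets borel" .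
  define f where "f x = (if x \<in> {-n..n} then max 0 (m x) else 0)" for x
  have cm: "continuous_on S (\<lambda>x. max 0 (m x))" for S
    by (intro continuous_intros continuous_on_subset[OF m]) auto
  have int: "((\<lambda>x. max 0 (m x)) has_integral integral {-n..n} (\<lambda>x. max 0 (m x))) {-n..n}"
    by (intro integrable_integral integrable_continuous_interval cm)
  have "A \<in> sets (lborel \<Otimes>\<^sub>M lborel)" using borel by (simp only: lborel_prod sets_lborel)
  then have "emeasure (lborel \<Otimes>\<^sub>M lborel) A = (\<integral>\<^sup>+ x. emeasure lborel (Pair x -` A) \<partial>lborel)"
    by (rule lborel.emeasure_pair_measure_alt)
  then have "emeasure lborel A = (\<integral>\<^sup>+ x. emeasure lborel (Pair x -` A) \<partial>lborel)"
    by (simp add: lborel_prod)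
  also have "\<dots> = (\<integral>\<^sup>+ x. ennreal (f x) \<partial>lborel)"
  proof (rule nn_integral_cong)
    fix x
    show "emeasure lborel (Pair x -` A) = ennreal (f x)"
    proof (cases "x \<in> {-n..n}")
      case True
      then have "Pair x -` A = {0<..<max 0 (m x)}" by (auto simp: A)
      then show ?thesis using True by (simp add: f_def)
    next
      case False
      then have "Pair x -` A = {}" by (auto simp: A)
      then show ?thesis using False by (auto simp: f_def)
    qed
  qed
  also have "\<dots> = ennreal (integral {-n..n} (\<lambda>x. max 0 (m x)))"
  proof (rule nn_integral_has_integral_lborel)
    show "(f has_integral integral {-n..n} (\<lambda>x. max 0 (m x))) UNIV"
      unfolding f_def[abs_def] by (subst has_integral_restrict_UNIV) (rule int)
    have "(\<lambda>x. max 0 (m x)) \<in> borel_measurable borel" by (intro borel_measurable_continuous_onI cm)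
    then show "f \<in> borel_measurable borel" unfolding f_def[abs_def] by measurable
  qed (auto simp: f_def)
  finally have "emeasure lborel A = ennreal (integral {-n..n} (\<lambda>x. max 0 (m x)))" .
  moreover have "integral {-n..n} m \<le> integral {-n..n} (\<lambda>x. max 0 (m x))"
    by (intro integral_le integrable_continuous_interval cm continuous_on_subset[OF m]) auto
  ultimately show "emeasure lborel A \<ge> ennreal (integral {-n..n} m)" by (simp add: ennreal_leI)
qed

text \<open>The duality argument with the field \<open>\<sigma> = (\<phi>1, \<phi>2)\<close>, where \<open>\<phi>1 = t(f(x) - y)\<close> and \<open>\<phi>2 = f'(x) \<phi>1\<close>.
  It is divergence free, both components are boundary test functions since
  \<open>0 \<le> f\<close> only on a bounded set, where \<open>f < h\<close>, and \<open>|\<sigma>|\<^sup>2 \<le> (1 + \<epsilon>\<^sup>2) \<phi>1\<close>. The step \<open>t\<close> equals \<open>1\<close> on \<open>[\<kappa>, \<infinity>)\<close>, so the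
  integral of \<open>\<phi>1\<close> is at least the area below the graph of \<open>f - \<kappa>\<close>.\<close>

lemma energy_ge_smooth_profile:
  fixes h f f' f'' :: "real \<Rightarrow> real"
  assumes lsc: "lower_semicont h"
    and u: "L2 (subgraph h) u" "has_weak_gradient (subgraph h) u g"
    and tr: "trace_eq_on h u (\<lambda>x. x) (tsupp h)"
    and f: "\<And>x. (f has_real_derivative f' x) (at x)" "\<And>x. (f' has_real_derivative f'' x) (at x)"
      "continuous_on UNIV f''" "\<And>x. \<bar>f' x\<bar> \<le> \<epsilon>"
    and \<epsilon>: "\<epsilon> \<le> 1" and \<kappa>: "\<kappa> > 0"
    and below: "\<And>x. 0 \<le> f x \<Longrightarrow> f x < h x" and supp: "\<And>x. 0 \<le> f x \<Longrightarrow> \<bar>x\<bar> \<le> N \<and> f x \<le> M"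
  shows "(1 - \<epsilon>\<^sup>2) * integral {-n..n} (\<lambda>x. f x - \<kappa>) \<le> (LINT p|lebesgue_on (subgraph h). (norm (g p))\<^sup>2)"
proof -
  define \<Omega> where "\<Omega> = subgraph h"
  define K where "K = {p::real \<times> real. 0 \<le> snd p \<and> snd p \<le> f (fst p)}"
  have cf: "continuous_on UNIV f" and cf': "continuous_on UNIV f'"
    using f(1,2) by (auto intro!: DERIV_isCont continuous_at_imp_continuous_on)
  have cff: "continuous_on UNIV (\<lambda>p::real \<times> real. f (fst p))"
    by (rule continuous_on_compose2[OF cf]) (auto intro!: continuous_intros)
  have "closed K" unfolding K_def
    by (intro closed_Collect_conj closed_Collect_le continuous_intros cff)
  moreover have "K \<subseteq> cbox (-N, 0) (N, M)"
  proof
    fix p assume "p \<in> K"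
    then have p: "0 \<le> snd p" "snd p \<le> f (fst p)" by (auto simp: K_def)
    then have "\<bar>fst p\<bar> \<le> N \<and> f (fst p) \<le> M" using supp[of "fst p"] by linarith
    then show "p \<in> cbox (-N, 0) (N, M)" using p by (auto simp: mem_cbox_prod_real)
  qed
  ultimately have K1: "compact K" using bounded_subset[OF bounded_cbox] by (auto simp: compact_eq_bounded_closed)
  have K2: "K \<subseteq> {p. snd p < h (fst p)}"
  proof
    fix p assume "p \<in> K"
    then have "0 \<le> f (fst p)" "snd p \<le> f (fst p)" by (auto simp: K_def)
    then show "p \<in> {p. snd p < h (fst p)}" using below[of "fst p"] by simp
  qed
  note ctx = lsc \<Omega>_def u[folded \<Omega>_def] tr K1 K2
  have \<Omega>m: "\<Omega> \<in> sets lebesgue" using open_subgraph[OF lsc] open_imp_lebesgue by (simp add: \<Omega>_def)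
  obtain d where d: "\<And>s. (smooth_step has_real_derivative d s) (at s)" "continuous_on UNIV d"
    using smooth_step_C1 by blast
  define t where "t s = smooth_step (s / \<kappa>)" for s
  define t' where "t' s = d (s / \<kappa>) / \<kappa>" for s
  have t: "(t has_real_derivative t' s) (at s)" for s
  proof -
    have "((\<lambda>s. s / \<kappa>) has_real_derivative 1 / \<kappa>) (at s)"
      using \<kappa> by (auto intro!: derivative_eq_intros)
    from DERIV_chain2[OF d(1) this] show ?thesis by (simp add: t_def[abs_def] t'_def)
  qed
  have ct': "continuous_on UNIV t'"
    unfolding t'_def[abs_def] using \<kappa> by (intro continuous_intros continuous_on_compose2[OF d(2)]) auto
  define \<phi>1 where "\<phi>1 p = t (f (fst p) - snd p)" for p :: "real \<times> real"
  define D1 where "D1 p = t' (f (fst p) - snd p) *\<^sub>R (f' (fst p) *\<^sub>R (1, 0) - (0 :: real, 1 :: real))" for p :: "real \<times> real"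
  define \<phi>2 where "\<phi>2 p = f' (fst p) * \<phi>1 p" for p
  define D2 where "D2 p = f' (fst p) *\<^sub>R D1 p + \<phi>1 p *\<^sub>R (f'' (fst p) *\<^sub>R (1 :: real, 0 :: real))" for p
  have C1: "C1_fun \<phi>1 D1"
    unfolding \<phi>1_def[abs_def] D1_def[abs_def]
    by (rule C1_fun_compose[OF C1_fun_diff[OF C1_fun_compose[OF C1_fun_fst f(1) cf'] C1_fun_snd] t ct'])
  have C2: "C1_fun \<phi>2 D2"
    unfolding \<phi>2_def[abs_def] D2_def[abs_def]
    by (rule C1_fun_mult[OF C1_fun_compose[OF C1_fun_fst f(2,3)] C1])
  have pos: "f (fst p) - snd p > 0" if "\<phi>1 p \<noteq> 0" for p
    using that smooth_step_eq_0[of "(f (fst p) - snd p) / \<kappa>"] \<kappa>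
    by (cases "f (fst p) - snd p \<le> 0") (auto simp: \<phi>1_def t_def divide_nonpos_pos)
  have B1: "boundary_test K \<phi>1 D1"
    unfolding boundary_test_def using C1 pos less_imp_le by (fastforce simp: K_def)
  have B2: "boundary_test K \<phi>2 D2"
    unfolding boundary_test_def using C2 pos less_imp_le by (fastforce simp: K_def \<phi>2_def)
  note E1 = extends_boundary_test[OF ctx B1] and E2 = extends_boundary_test[OF ctx B2]
  note I1 = boundary_test_integrable[OF ctx B1] and I2 = boundary_test_integrable[OF ctx B2]
  define w where "w p = u p - fst p" for p
  define q where "q p = g p - (1 :: real, 0 :: real)" for p
  have i1: "integrable (lebesgue_on \<Omega>) (\<lambda>p. w p * fst (D1 p))" "integrable (lebesgue_on \<Omega>) (\<lambda>p. \<phi>1 p * fst (q p))"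
    "integrable (lebesgue_on \<Omega>) \<phi>1"
    using integrable_bounded_linear[OF bounded_linear_fst I1(5)] integrable_bounded_linear[OF bounded_linear_fst I1(6)]
      integrable_bounded_linear[OF bounded_linear_fst I1(4)] by (simp_all add: w_def q_def)
  have i2: "integrable (lebesgue_on \<Omega>) (\<lambda>p. w p * snd (D2 p))" "integrable (lebesgue_on \<Omega>) (\<lambda>p. \<phi>2 p * snd (q p))"
    using integrable_bounded_linear[OF bounded_linear_snd I2(5)] integrable_bounded_linear[OF bounded_linear_snd I2(6)]
    by (simp_all add: w_def q_def)
  have "(LINT p|lebesgue_on \<Omega>. w p * fst (D1 p)) = - (LINT p|lebesgue_on \<Omega>. \<phi>1 p * fst (q p))"
    using arg_cong[OF E1[unfolded extends_by_zero_def], of fst]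
      integral_bounded_linear[OF bounded_linear_fst I1(5)] integral_bounded_linear[OF bounded_linear_fst I1(6)]
    by (simp add: w_def q_def)
  moreover have "(LINT p|lebesgue_on \<Omega>. w p * snd (D2 p)) = - (LINT p|lebesgue_on \<Omega>. \<phi>2 p * snd (q p))"
    using arg_cong[OF E2[unfolded extends_by_zero_def], of snd]
      integral_bounded_linear[OF bounded_linear_snd I2(5)] integral_bounded_linear[OF bounded_linear_snd I2(6)]
    by (simp add: w_def q_def)
  \<comment> \<open>The field is divergence free.\<close>
  moreover have "w p * snd (D2 p) = - (w p * fst (D1 p))" for p
    by (simp add: D1_def D2_def)
  ultimately have Z: "(LINT p|lebesgue_on \<Omega>. \<phi>1 p * fst (q p) + \<phi>2 p * snd (q p)) = 0"
    using i1 i2 by simp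
  have \<phi>1: "0 \<le> \<phi>1 p" "\<phi>1 p \<le> 1" for p by (auto simp: \<phi>1_def t_def smooth_step_range)
  have pw: "2 * (\<phi>1 p * fst (q p) + \<phi>2 p * snd (q p)) + (1 - \<epsilon>\<^sup>2) * \<phi>1 p \<le> (norm (g p))\<^sup>2" for p
  proof -
    obtain a b where g: "g p = (a, b)" by (cases "g p")
    have "0 \<le> (a - \<phi>1 p)\<^sup>2 + (b - \<phi>2 p)\<^sup>2" by simp
    then have "2 * (\<phi>1 p * a + \<phi>2 p * b) \<le> a\<^sup>2 + b\<^sup>2 + ((\<phi>1 p)\<^sup>2 + (\<phi>2 p)\<^sup>2)"
      by (simp add: power2_eq_square algebra_simps)
    moreover have "(\<phi>1 p)\<^sup>2 + (\<phi>2 p)\<^sup>2 \<le> (1 + \<epsilon>\<^sup>2) * \<phi>1 p"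
    proof -
      have "(f' (fst p))\<^sup>2 \<le> \<epsilon>\<^sup>2" using f(4)[of "fst p"] by (metis abs_ge_zero power2_abs power_mono)
      moreover have "(\<phi>1 p)\<^sup>2 \<le> \<phi>1 p" using \<phi>1[of p] by (simp add: power2_eq_square mult_left_le)
      ultimately have "(1 + (f' (fst p))\<^sup>2) * (\<phi>1 p)\<^sup>2 \<le> (1 + \<epsilon>\<^sup>2) * \<phi>1 p"
        by (intro mult_mono) auto
      then show ?thesis by (simp add: \<phi>2_def power_mult_distrib algebra_simps)
    qed
    ultimately show ?thesis by (simp add: g q_def norm_Pair algebra_simps)
  qed
  have gL2: "integrable (lebesgue_on \<Omega>) (\<lambda>p. (norm (g p))\<^sup>2)"
    using u(2) by (simp add: has_weak_gradient_def L2_def \<Omega>_def)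
  have "(1 - \<epsilon>\<^sup>2) * (LINT p|lebesgue_on \<Omega>. \<phi>1 p)
      = (LINT p|lebesgue_on \<Omega>. 2 * (\<phi>1 p * fst (q p) + \<phi>2 p * snd (q p)) + (1 - \<epsilon>\<^sup>2) * \<phi>1 p)"
    using i1 i2 Z by simp
  also have "\<dots> \<le> (LINT p|lebesgue_on \<Omega>. (norm (g p))\<^sup>2)"
    by (intro integral_mono gL2 pw Bochner_Integration.integrable_add integrable_mult_right i1 i2)
  finally have E: "(1 - \<epsilon>\<^sup>2) * (LINT p|lebesgue_on \<Omega>. \<phi>1 p) \<le> (LINT p|lebesgue_on \<Omega>. (norm (g p))\<^sup>2)" .
  define A where "A = {p. -n \<le> fst p \<and> fst p \<le> n \<and> 0 < snd p \<and> snd p < f (fst p) - \<kappa>}"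
  have cfk: "continuous_on UNIV (\<lambda>x. f x - \<kappa>)" by (intro continuous_intros cf)
  note area = area_under_graph[OF cfk A_def]
  have "A \<subseteq> K" using \<kappa> by (auto simp: A_def K_def)
  then have "bounded A" using K1 compact_imp_bounded bounded_subset by blast
  then have Al: "A \<in> lmeasurable" using area(1) by (intro bounded_set_imp_lmeasurable) (auto intro: sets_completionI_sets)
  have "A \<subseteq> \<Omega>"
  proof
    fix p assume p: "p \<in> A"
    then have "0 \<le> f (fst p)" "0 < snd p" "snd p < f (fst p)" using \<kappa> by (auto simp: A_def)
    then have "0 < snd p \<and> snd p < h (fst p)" using below[of "fst p"] by linarith
    then show "p \<in> \<Omega>" by (cases p) (simp add: \<Omega>_def subgraph_def)
  qed
  have "ennreal (integral {-n..n} (\<lambda>x. f x - \<kappa>)) \<le> ennreal (measure lebesgue A)"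
  proof -
    have "emeasure lebesgue A = emeasure lborel A" using area(1) by simp
    moreover have "emeasure lebesgue A = ennreal (measure lebesgue A)"
      by (rule emeasure_eq_ennreal_measure) (use Al fmeasurableD2 in blast)
    ultimately show ?thesis using area(2) by simp
  qed
  then have "integral {-n..n} (\<lambda>x. f x - \<kappa>) \<le> measure lebesgue A" by simp
  also have "measure lebesgue A = (LINT p|lebesgue_on \<Omega>. indicat_real A p)"
  proof -
    have "(LINT p|lebesgue_on UNIV. indicat_real A p) = (LINT p|lebesgue_on A. indicat_real A p)"
      by (rule lebesgue_integral_on_subset) (use Al in auto)
    moreover have "(LINT p|lebesgue_on \<Omega>. indicat_real A p) = (LINT p|lebesgue_on A. indicat_real A p)"
      by (rule lebesgue_integral_on_subset) (use Al \<Omega>m \<open>A \<subseteq> \<Omega>\<close> in auto)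
    ultimately show ?thesis using Al by (simp add: lebesgue_on_UNIV_eq)
  qed
  also have "\<dots> \<le> (LINT p|lebesgue_on \<Omega>. \<phi>1 p)"
  proof (rule integral_mono)
    have "integrable (lebesgue_on UNIV) (indicat_real A)"
      using Al by (simp add: lebesgue_on_UNIV_eq lmeasurable_iff_integrable)
    then show "integrable (lebesgue_on \<Omega>) (indicat_real A)"
      by (rule integrable_lebesgue_on_subset) (use \<Omega>m in auto)
    show "indicat_real A p \<le> \<phi>1 p" for p
    proof (cases "p \<in> A")
      case True
      then have "(f (fst p) - snd p) / \<kappa> \<ge> 1" using \<kappa> by (simp add: A_def)
      then show ?thesis using True by (simp add: \<phi>1_def t_def smooth_step_eq_1)
    qed (use \<phi>1 in auto)
  qed (rule i1(3))
  finally have "integral {-n..n} (\<lambda>x. f x - \<kappa>) \<le> (LINT p|lebesgue_on \<Omega>. \<phi>1 p)" .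
  moreover have "0 \<le> 1 - \<epsilon>\<^sup>2"
  proof -
    have "0 \<le> \<epsilon>" using f(4)[of 0] by linarith
    then show ?thesis using \<epsilon> by (simp add: power_le_one)
  qed
  ultimately have "(1 - \<epsilon>\<^sup>2) * integral {-n..n} (\<lambda>x. f x - \<kappa>) \<le> (1 - \<epsilon>\<^sup>2) * (LINT p|lebesgue_on \<Omega>. \<phi>1 p)"
    by (rule mult_left_mono)
  with E show ?thesis by (simp add: \<Omega>_def)
qed

lemma abs_min_diff_le:
  fixes a b c d :: real
  assumes "\<bar>a - b\<bar> \<le> e" "\<bar>c - d\<bar> \<le> e" shows "\<bar>min a c - min b d\<bar> \<le> e"
  using assms by (auto simp: min_def abs_le_iff)

lemma tent_lipschitz:
  fixes \<epsilon> N x y :: real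
  assumes "\<epsilon> \<ge> 0" shows "\<bar>max 0 (\<epsilon> * (N - \<bar>x\<bar>)) - max 0 (\<epsilon> * (N - \<bar>y\<bar>))\<bar> \<le> \<epsilon> * \<bar>x - y\<bar>"
proof -
  have "\<bar>\<epsilon> * (N - \<bar>x\<bar>) - \<epsilon> * (N - \<bar>y\<bar>)\<bar> = \<epsilon> * \<bar>\<bar>y\<bar> - \<bar>x\<bar>\<bar>"
    using assms by (simp add: abs_mult flip: right_diff_distrib)
  also have "\<dots> \<le> \<epsilon> * \<bar>x - y\<bar>" using assms by (intro mult_left_mono) auto
  finally show ?thesis by (auto simp: max_def abs_le_iff)
qed

text \<open>The infimal convolution need not have compact support. Its minimum with a tent of slope \<open>\<epsilon>\<close> has, is
  still \<open>\<epsilon>\<close>-Lipschitz, and coincides with it on \<open>[-n, n]\<close> if the tent is wide. A smooth approximation,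
  lowered by a small amount, then serves as profile.\<close>

lemma energy_ge_inf_conv:
  fixes h :: "real \<Rightarrow> real"
  assumes lsc: "lower_semicont h" and h: "\<And>x. 0 \<le> h x"
    and u: "L2 (subgraph h) u" "has_weak_gradient (subgraph h) u g"
    and tr: "trace_eq_on h u (\<lambda>x. x) (tsupp h)"
    and \<epsilon>: "0 < \<epsilon>" "\<epsilon> \<le> 1" and n: "n \<ge> 0"
  shows "(1 - \<epsilon>\<^sup>2) * integral {-n..n} (inf_conv \<epsilon> h) \<le> (LINT p|lebesgue_on (subgraph h). (norm (g p))\<^sup>2)"
proof (rule field_le_epsilon)
  fix e :: real assume e: "e > 0"
  let ?k0 = "inf_conv \<epsilon> h" and ?E = "LINT p|lebesgue_on (subgraph h). (norm (g p))\<^sup>2"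
  \<comment> \<open>The profile stays within \<open>4 \<tau>\<close> of the infimal convolution on an interval of length \<open>2 n\<close>.\<close>
  define \<tau> where "\<tau> = e / (8 * n + 1)"
  have \<tau>: "\<tau> > 0" "8 * n * \<tau> \<le> e" using e n by (auto simp: \<tau>_def field_simps)
  note lip0 = inf_conv_lipschitz[where h = h, OF h \<epsilon>(1)]
  have "continuous_on {-n..n} ?k0" by (rule lipschitz_continuous_on[OF lip0])
  then obtain B where B: "\<And>x. x \<in> {-n..n} \<Longrightarrow> norm (?k0 x) \<le> B"
    using compact_continuous_image[of "{-n..n}" ?k0] compact_imp_bounded
    by (metis bounded_iff compact_Icc imageI)
  \<comment> \<open>With this width the tent has height at least \<open>B\<close> over \<open>[-n, n]\<close>.\<close>
  define N where "N = n + B / \<epsilon>"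
  define k where "k x = min (?k0 x) (max 0 (\<epsilon> * (N - \<bar>x\<bar>)))" for x
  have k_eq: "k x = ?k0 x" if "x \<in> {-n..n}" for x
  proof -
    have "?k0 x \<le> B" using B[OF that] by simp
    also have "B = \<epsilon> * (N - n)" using \<epsilon> by (simp add: N_def)
    also have "\<dots> \<le> \<epsilon> * (N - \<bar>x\<bar>)" using \<epsilon> that by (intro mult_left_mono) auto
    finally show ?thesis by (simp add: k_def min_def)
  qed
  have lip: "\<bar>k x - k y\<bar> \<le> \<epsilon> * \<bar>x - y\<bar>" for x y
    unfolding k_def using \<epsilon> by (intro abs_min_diff_le lip0 tent_lipschitz) auto
  obtain f0 f' f'' where f: "\<And>x. (f0 has_real_derivative f' x) (at x)" "\<And>x. (f' has_real_derivative f'' x) (at x)"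
    "continuous_on UNIV f''" "\<And>x. \<bar>f' x\<bar> \<le> \<epsilon>" "\<And>x. \<bar>f0 x - k x\<bar> \<le> \<tau>"
    using C2_approximation_of_lipschitz[OF lip \<tau>(1)] by blast
  define f where "f x = f0 x - 2 * \<tau>" for x
  have fk: "f x \<le> k x - \<tau>" "k x - 3 * \<tau> \<le> f x" for x using f(5)[of x] by (auto simp: f_def abs_le_iff)
  have df: "(f has_real_derivative f' x) (at x)" for x
    unfolding f_def[abs_def] by (auto intro!: derivative_eq_intros f)
  have tent: "\<bar>x\<bar> \<le> N \<and> f x \<le> \<epsilon> * N" if "0 \<le> f x" for x
  proof -
    have "0 < k x" using fk(1)[of x] that \<tau> by linarith
    then have p: "0 < \<epsilon> * (N - \<bar>x\<bar>)" and kx: "k x \<le> \<epsilon> * (N - \<bar>x\<bar>)" by (auto simp: k_def)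
    from p have "\<bar>x\<bar> < N" using \<epsilon> by (simp add: zero_less_mult_iff)
    moreover have "\<epsilon> * (N - \<bar>x\<bar>) \<le> \<epsilon> * N" using \<epsilon> by (intro mult_left_mono) auto
    ultimately show ?thesis using kx fk(1)[of x] \<tau> by linarith
  qed
  have kh: "k x \<le> h x" for x using inf_conv_le[where h = h, OF h \<epsilon>(1), of x] by (simp add: k_def)
  have E: "(1 - \<epsilon>\<^sup>2) * integral {-n..n} (\<lambda>x. f x - \<tau>) \<le> ?E"
  proof (rule energy_ge_smooth_profile[OF lsc u tr df f(2,3,4) \<epsilon>(2) \<tau>(1) _ tent])
    show "f x < h x" for x using fk(1)[of x] kh[of x] \<tau> by linarith
  qed
  have ck: "continuous_on S k" for S by (rule lipschitz_continuous_on[OF lip])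
  have cf: "continuous_on S f" for S
    using df by (auto intro!: DERIV_isCont continuous_at_imp_continuous_on)
  have "integral {-n..n} ?k0 - 4 * \<tau> * (2 * n) = integral {-n..n} (\<lambda>x. k x - 4 * \<tau>)"
  proof -
    have "integral {-n..n} ?k0 = integral {-n..n} k" by (rule integral_cong) (simp add: k_eq)
    moreover have "integral {-n..n} (\<lambda>x. k x - 4 * \<tau>) = integral {-n..n} k - integral {-n..n} (\<lambda>x. 4 * \<tau>)"
      by (intro Henstock_Kurzweil_Integration.integral_diff integrable_continuous_interval ck) auto
    ultimately show ?thesis using n by simp
  qed
  also have "\<dots> \<le> integral {-n..n} (\<lambda>x. f x - \<tau>)"
  proof (rule integral_le)
    show "k x - 4 * \<tau> \<le> f x - \<tau>" for x using fk(2)[of x] by linarith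
  qed (intro integrable_continuous_interval continuous_intros ck cf)+
  finally have le: "integral {-n..n} ?k0 - 8 * n * \<tau> \<le> integral {-n..n} (\<lambda>x. f x - \<tau>)" by (simp add: mult_ac)
  have c01: "0 \<le> 1 - \<epsilon>\<^sup>2" "1 - \<epsilon>\<^sup>2 \<le> 1" using \<epsilon> by (auto simp: power_le_one)
  have "(1 - \<epsilon>\<^sup>2) * integral {-n..n} ?k0 = (1 - \<epsilon>\<^sup>2) * (integral {-n..n} ?k0 - 8 * n * \<tau>) + (1 - \<epsilon>\<^sup>2) * (8 * n * \<tau>)"
    by (simp add: algebra_simps)
  also have "\<dots> \<le> ?E + e"
  proof (rule add_mono)
    show "(1 - \<epsilon>\<^sup>2) * (integral {-n..n} ?k0 - 8 * n * \<tau>) \<le> ?E"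
      using mult_left_mono[OF le c01(1)] E by linarith
    have "(1 - \<epsilon>\<^sup>2) * (8 * n * \<tau>) \<le> 1 * (8 * n * \<tau>)" using c01 n \<tau> by (intro mult_right_mono) auto
    then show "(1 - \<epsilon>\<^sup>2) * (8 * n * \<tau>) \<le> e" using \<tau>(2) by linarith
  qed
  finally show "(1 - \<epsilon>\<^sup>2) * integral {-n..n} ?k0 \<le> ?E + e" .
qed

lemma integral_symmetric_interval_tendsto:
  fixes h :: "real \<Rightarrow> real"
  assumes "integrable lebesgue h"
  shows "(\<lambda>n::nat. integral {-real n..real n} h) \<longlonglongrightarrow> (LINT x|lebesgue. h x)"
    and "h integrable_on {a..b}"
proof -
  have "integrable (lebesgue_on UNIV) h" using assms by (simp add: lebesgue_on_UNIV_eq)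
  then have I: "integrable (lebesgue_on {a..b}) h" for a b
    by (rule integrable_lebesgue_on_subset) auto
  then show "h integrable_on {a..b}" by (intro integrable_on_lebesgue_on) auto
  have eq: "integral {-real n..real n} h = (LINT x|lebesgue. indicat_real {-real n..real n} x *\<^sub>R h x)" for n
    using lebesgue_integral_eq_integral[OF I] by (simp add: integral_restrict_space)
  show "(\<lambda>n::nat. integral {-real n..real n} h) \<longlonglongrightarrow> (LINT x|lebesgue. h x)"
    unfolding eq
  proof (rule integral_dominated_convergence[where w = "\<lambda>x. norm (h x)"])
    show "AE x in lebesgue. (\<lambda>n. indicat_real {-real n..real n} x *\<^sub>R h x) \<longlonglongrightarrow> h x"
    proof (rule AE_I2)
      fix x
      have "\<forall>\<^sub>F n::nat in sequentially. \<bar>x\<bar> \<le> real n"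
        using eventually_ge_at_top[of "nat \<lceil>\<bar>x\<bar>\<rceil>"] by eventually_elim linarith
      then have "\<forall>\<^sub>F n in sequentially. indicat_real {-real n..real n} x *\<^sub>R h x = h x"
        by eventually_elim (auto simp: indicator_def abs_le_iff)
      then show "(\<lambda>n. indicat_real {-real n..real n} x *\<^sub>R h x) \<longlonglongrightarrow> h x" by (rule tendsto_eventually)
    qed
    show "AE x in lebesgue. norm (indicat_real {-real n..real n} x *\<^sub>R h x) \<le> norm (h x)" for n
      by (auto simp: indicator_def)
    show "(\<lambda>x. indicat_real {-real n..real n} x *\<^sub>R h x) \<in> borel_measurable lebesgue" for n
      using assms by (intro borel_measurable_scaleR borel_measurable_indicator) auto
  qed (use assms in auto)
qed

text \<open>By the shift estimate for the left variation, replacing \<open>h\<close> by its infimal convolution costs at most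
  \<open>2 (W / \<epsilon>) W\<close> in area, uniformly in the interval of integration.\<close>

lemma energy_lower_bound:
  fixes h :: "real \<Rightarrow> real"
  assumes lsc: "lower_semicont h" and h: "\<And>x. 0 \<le> h x" "integrable lebesgue h"
    and u: "L2 (subgraph h) u" "has_weak_gradient (subgraph h) u g"
    and tr: "trace_eq_on h u (\<lambda>x. x) (tsupp h)"
    and W: "\<And>xs. sorted_wrt (<) xs \<Longrightarrow> list_variation h xs \<le> W"
    and \<epsilon>: "0 < \<epsilon>" "\<epsilon> \<le> 1"
  shows "(1 - \<epsilon>\<^sup>2) * ((LINT x|lebesgue. h x) - 2 * (W / \<epsilon>) * W)
    \<le> (LINT p|lebesgue_on (subgraph h). (norm (g p))\<^sup>2)" (is "_ \<le> ?E")
proof -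
  let ?r = "W / \<epsilon>" and ?v = "left_variation h"
  have "W \<ge> 0" using W[of "[]"] by (simp add: list_variation_def)
  then have r: "?r \<ge> 0" using \<epsilon> by simp
  have c: "0 \<le> 1 - \<epsilon>\<^sup>2" using \<epsilon> by (simp add: power_le_one)
  have bound: "(1 - \<epsilon>\<^sup>2) * (integral {-real n..real n} h - 2 * ?r * W) \<le> ?E" for n :: nat
  proof -
    have ic: "inf_conv \<epsilon> h integrable_on {-real n..real n}"
      by (intro integrable_continuous_interval lipschitz_continuous_on[OF inf_conv_lipschitz[where h = h, OF h(1) \<epsilon>(1)]])
    have "integral {-real n..real n} h - integral {-real n..real n} (inf_conv \<epsilon> h)
        = integral {-real n..real n} (\<lambda>x. h x - inf_conv \<epsilon> h x)"
      using integral_symmetric_interval_tendsto(2)[OF h(2)] ic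
      by (simp add: Henstock_Kurzweil_Integration.integral_diff)
    also have "\<dots> \<le> integral {-real n..real n} (\<lambda>x. ?v (x + ?r) - ?v (x - ?r))"
    proof (rule integral_le)
      show "(\<lambda>x. h x - inf_conv \<epsilon> h x) integrable_on {-real n..real n}"
        using integral_symmetric_interval_tendsto(2)[OF h(2)] ic by (rule integrable_diff)
    qed (use integral_left_variation_shift(1)[OF W r] inf_conv_deficit[where h = h, OF h(1) \<epsilon>(1) W] in auto)
    also have "\<dots> \<le> 2 * ?r * W" by (rule integral_left_variation_shift(2)[OF W r]) auto
    finally have "integral {-real n..real n} h - 2 * ?r * W \<le> integral {-real n..real n} (inf_conv \<epsilon> h)"
      by linarith
    from mult_left_mono[OF this c] energy_ge_inf_conv[OF lsc h(1) u tr \<epsilon>, of "real n"]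
    show ?thesis by linarith
  qed
  have "(\<lambda>n::nat. (1 - \<epsilon>\<^sup>2) * (integral {-real n..real n} h - 2 * ?r * W))
      \<longlonglongrightarrow> (1 - \<epsilon>\<^sup>2) * ((LINT x|lebesgue. h x) - 2 * ?r * W)"
    by (intro tendsto_intros integral_symmetric_interval_tendsto(1)[OF h(2)])
  from LIMSEQ_le_const2[OF this] show ?thesis using bound by blast
qed

text \<open>If \<open>W < V < \<epsilon> / 2\<close>, the area loss \<open>2 W\<^sup>2 / \<epsilon>\<close> is at most \<open>W\<close> and is compensated by the
  variation term; if \<open>W \<ge> V\<close>, the variation term alone suffices.\<close>

lemma F_ell_lower_bound:
  assumes \<epsilon>: "0 < \<epsilon>" "\<epsilon> \<le> 1" and V: "0 < V" "V < \<epsilon> / 2"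
  shows "ereal ((1 - \<epsilon>\<^sup>2) * V) \<le> F_ell V"
  unfolding F_ell_def
proof (rule INF_greatest, clarify)
  fix u h assume "(u, h) \<in> admissible V"
  then have BV: "h \<in> BV" and lsc: "lower_semicont h" and h: "\<And>x. 0 \<le> h x" and u: "u \<in> H1 (subgraph h)"
    and vol: "(LINT x|lebesgue. h x) = V" and tr: "trace_eq_on h u (\<lambda>x. x) (tsupp h)"
    by (auto simp: admissible_def)
  have int: "integrable lebesgue h" using BV by (simp add: BV_def)
  have uL2: "L2 (subgraph h) u" using u by (simp add: H1_def)
  have g: "has_weak_gradient (subgraph h) u (weak_grad (subgraph h) u)"
    using u has_weak_gradient_weak_grad by (auto simp: H1_def)
  let ?E = "dirichlet (subgraph h) u"
  have E0: "0 \<le> ?E" by (simp add: dirichlet_def)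
  have le: "ereal (list_variation h xs) \<le> pointwise_variation h" if "sorted_wrt (<) xs" for xs
    unfolding pointwise_variation_eq by (rule SUP_upper) (use that in simp)
  have c: "0 \<le> 1 - \<epsilon>\<^sup>2" "1 - \<epsilon>\<^sup>2 \<le> 1" using \<epsilon> by (auto simp: power_le_one)
  show "ereal ((1 - \<epsilon>\<^sup>2) * V) \<le> ereal ?E + pointwise_variation h"
  proof (cases "pointwise_variation h")
    case (real W)
    have W: "list_variation h xs \<le> W" if "sorted_wrt (<) xs" for xs using le[OF that] real by simp
    have W0: "0 \<le> W" using W[of "[]"] by (simp add: list_variation_def)
    have "(1 - \<epsilon>\<^sup>2) * V \<le> ?E + W"
    proof (cases "W \<ge> V")
      case True
      have "(1 - \<epsilon>\<^sup>2) * V \<le> 1 * V" using c V by (intro mult_right_mono) auto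
      then show ?thesis using True E0 by linarith
    next
      case False
      have "2 * (W / \<epsilon>) * W \<le> 1 * W"
        using False V \<epsilon> W0 by (intro mult_right_mono) (auto simp: field_simps)
      then have "(1 - \<epsilon>\<^sup>2) * (2 * (W / \<epsilon>) * W) \<le> 1 * W"
        using c W0 \<epsilon> mult_mono[of "1 - \<epsilon>\<^sup>2" 1 "2 * (W / \<epsilon>) * W" W] by simp
      moreover have "(1 - \<epsilon>\<^sup>2) * (V - 2 * (W / \<epsilon>) * W) \<le> ?E"
        using energy_lower_bound[OF lsc h int uL2 g tr W \<epsilon>] by (simp add: vol dirichlet_def)
      ultimately show ?thesis by (simp add: right_diff_distrib)
    qed
    then show ?thesis using real by simp
  next
    case PInf
    then show ?thesis by simp
  next
    case MInf
    then show ?thesis using le[of "[]"] by (simp add: list_variation_def)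
  qed
qed

section \<open>Flat films and the asymptotics of the minimal energy\<close>

text \<open>The open interval makes the profile lower semicontinuous.\<close>

definition plateau :: "real \<Rightarrow> real \<Rightarrow> real \<Rightarrow> real" where
  "plateau e l x = (if 0 < x \<and> x < l then e else 0)"

lemma subgraph_plateau: "subgraph (plateau e l) = box (0, 0) (l, e)"
  by (auto simp: subgraph_def plateau_def mem_box_prod_real split: if_splits)

lemma plateau_indicator: "plateau e l x = indicat_real {0<..<l} x *\<^sub>R e"
  by (simp add: plateau_def indicator_def)

lemma lower_semicont_plateau: "0 \<le> e \<Longrightarrow> lower_semicont (plateau e l)"
  unfolding lower_semicont_def
proof (intro allI impI)
  fix x c assume e: "0 \<le> e" and c: "c < plateau e l x"
  show "\<forall>\<^sub>F y in nhds x. c < plateau e l y"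
  proof (cases "x \<in> {0<..<l}")
    case True
    have "\<forall>\<^sub>F y in nhds x. y \<in> {0<..<l}"
      by (rule eventually_nhds_in_open) (use True in auto)
    then show ?thesis
      by eventually_elim (use c True in \<open>auto simp: plateau_def\<close>)
  next
    case False
    then have "c < 0" using c by (auto simp: plateau_def)
    then show ?thesis using e by (auto simp: plateau_def intro!: always_eventually)
  qed
qed

text \<open>The jumps of the plateau are increments of the monotone step function \<open>s\<close> with total increment
  \<open>2 e\<close>, and these telescope along a chain.\<close>

lemma list_variation_plateau:
  assumes e: "0 \<le> e" and l: "0 < l" and xs: "sorted_wrt (<) xs"
  shows "list_variation (plateau e l) xs \<le> 2 * e"
proof -
  \<comment> \<open>One upward jump of size \<open>e\<close> at each endpoint of the plateau.\<close>
  define s where "s x = (if 0 < x then e else 0) + (if l \<le> x then e else 0)" for x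
  have jump: "\<bar>plateau e l y - plateau e l x\<bar> \<le> s y - s x" if "x \<le> y" for x y
    using that e l by (auto simp: plateau_def s_def)
  have s: "0 \<le> s x" "s x \<le> 2 * e" for x using e by (auto simp: s_def)
  have "list_variation (plateau e l) xs \<le> (if xs = [] then 0 else s (last xs))"
    using xs
  proof (induction xs rule: rev_induct)
    case Nil
    then show ?case by (simp add: list_variation_def)
  next
    case (snoc a xs)
    show ?case
    proof (cases "xs = []")
      case True
      then show ?thesis using s by (simp add: list_variation_def)
    next
      case False
      then have "last xs \<le> a" using snoc.prems by (auto simp: sorted_wrt_append less_imp_le)
      from jump[OF this] show ?thesis using snoc False
        by (simp add: list_variation_snoc sorted_wrt_append)
    qed
  qed
  also have "\<dots> \<le> 2 * e" using s e by simp
  finally show ?thesis .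
qed

lemma integrable_plateau: "integrable lebesgue (plateau e l)"
  and integral_plateau: "0 \<le> l \<Longrightarrow> (LINT x|lebesgue. plateau e l x) = l * e"
proof -
  have "{0<..<l} \<in> lmeasurable" by (rule bounded_set_imp_lmeasurable) auto
  then have i: "integrable lebesgue (indicat_real {0<..<l})" by (simp add: lmeasurable_iff_integrable)
  show "integrable lebesgue (plateau e l)"
    unfolding plateau_indicator[abs_def] by (rule integrable_scaleR_left) (use i in simp)
  show "(LINT x|lebesgue. plateau e l x) = l * e" if "0 \<le> l"
    unfolding plateau_indicator using i that by simp
qed

lemma plateau_BV:
  assumes e: "0 \<le> e" and l: "0 < l" shows "plateau e l \<in> BV"
  unfolding BV_def
proof (intro CollectI conjI integrable_plateau exI[of _ "2 * e"] allI impI, elim conjE)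
  fix \<phi> D\<phi> assume t: "test_fun UNIV \<phi> D\<phi>" and b: "\<forall>x::real. \<bar>\<phi> x\<bar> \<le> 1"
  then have C1: "C1_fun \<phi> D\<phi>" by (simp add: test_fun_def)
  have D: "(\<phi> has_real_derivative D\<phi> x) (at x)" for x
    using C1 by (simp add: C1_fun_def gderiv_def has_field_derivative_def mult_commute_abs)
  have c: "continuous_on {0..l} D\<phi>" by (rule C1_fun_grad_continuous[OF C1])
  have "integrable (lebesgue_on {0..l}) D\<phi>" by (rule continuous_imp_integrable_real[OF c])
  then have i: "integrable (lebesgue_on {0<..<l}) D\<phi>" by (rule integrable_lebesgue_on_subset) auto
  have "(LINT x|lebesgue. plateau e l x * D\<phi> x) = (LINT x|lebesgue. e * (indicat_real {0<..<l} x *\<^sub>R D\<phi> x))"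
    by (rule Bochner_Integration.integral_cong) (auto simp: plateau_indicator)
  also have "\<dots> = e * (LINT x|lebesgue_on {0<..<l}. D\<phi> x)"
    by (simp add: integral_restrict_space)
  also have "(LINT x|lebesgue_on {0<..<l}. D\<phi> x) = integral {0..l} D\<phi>"
    using lebesgue_integral_eq_integral[OF i] by (simp add: integral_open_interval_real)
  also have "integral {0..l} D\<phi> = \<phi> l - \<phi> 0"
    using l D by (intro integral_unique fundamental_theorem_of_calculus)
      (auto simp flip: has_real_derivative_iff_has_vector_derivative intro: has_field_derivative_at_within)
  also have "e * (\<phi> l - \<phi> 0) \<le> e * 2"
    using b[rule_format, of l] b[rule_format, of 0] e by (intro mult_left_mono) auto
  finally show "(LINT x|lebesgue. plateau e l x * D\<phi> x) \<le> 2 * e" by simp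
qed

lemma has_weak_gradient_fst_box:
  fixes a b c d :: real
  shows "has_weak_gradient (box (a, c) (b, d)) fst (\<lambda>p. (1, 0))"
  unfolding has_weak_gradient_def
  by (intro conjI allI impI L2_continuous_rectangle continuous_intros weak_gradient_fst) auto

lemma dirichlet_fst_box:
  fixes a b c d :: real
  assumes "a \<le> b" "c \<le> d"
  shows "dirichlet (box (a, c) (b, d)) fst = (b - a) * (d - c)"
proof -
  let ?R = "box (a, c) (b, d)"
  note g = has_weak_gradient_fst_box[of a c b d]
  have g': "has_weak_gradient ?R fst (weak_grad ?R fst)" by (rule has_weak_gradient_weak_grad[OF g])
  have ae: "AE p in lebesgue_on ?R. (norm (weak_grad ?R fst p))\<^sup>2 = 1"
    using weak_gradient_unique_box[OF g' g] by eventually_elim (simp add: norm_Pair)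
  have "dirichlet ?R fst = (LINT p|lebesgue_on ?R. 1)"
    unfolding dirichlet_def
    by (rule integral_cong_AE[OF _ _ ae]) (use g' in \<open>auto simp: has_weak_gradient_def L2_def\<close>)
  also have "\<dots> = measure lebesgue ?R" by (simp add: measure_restrict_space)
  also have "\<dots> = (b - a) * (d - c)"
    using assms by (simp add: measure_lborel_box_eq Basis_prod_def sum.union_disjoint prod.union_disjoint)
  finally show ?thesis .
qed

lemma plateau_admissible:
  assumes e: "0 < e" and l: "0 < l"
  shows "(fst, plateau e l) \<in> admissible (l * e)"
proof -
  have tr: "trace_eq_on (plateau e l) fst (\<lambda>x. x) (tsupp (plateau e l))"
    unfolding trace_eq_on_def
  proof (intro allI impI exI conjI)
    fix a b c :: real
    show "bottom_trace a b c fst (\<lambda>x. x)" by (rule bottom_trace_fst[OF has_weak_gradient_fst_box])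
  qed simp
  have "fst \<in> H1 (subgraph (plateau e l))"
    unfolding H1_def subgraph_plateau
    by (intro CollectI conjI exI[of _ "\<lambda>p. (1, 0)"] L2_continuous_rectangle continuous_intros
        has_weak_gradient_fst_box)
  then show ?thesis
    unfolding admissible_def using e l tr plateau_BV[of e l] lower_semicont_plateau[of e l]
    by (auto simp: integral_plateau) (simp add: plateau_def)
qed

lemma F_ell_upper_bound:
  assumes V: "0 < V" shows "F_ell V \<le> ereal V"
proof (rule ereal_le_epsilon2)
  fix \<epsilon> :: real assume \<epsilon>: "0 < \<epsilon>"
  define e where "e = \<epsilon> / 2"
  define l where "l = V / e"
  have e: "0 < e" "0 < l" "l * e = V" using \<epsilon> V by (auto simp: e_def l_def)
  have "F_ell V \<le> ereal (dirichlet (subgraph (plateau e l)) fst) + pointwise_variation (plateau e l)"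
    unfolding F_ell_def using plateau_admissible[OF e(1,2)] e(3) by (intro INF_lower2) auto
  also have "\<dots> \<le> ereal V + ereal (2 * e)"
  proof (intro add_mono)
    show "ereal (dirichlet (subgraph (plateau e l)) fst) \<le> ereal V"
      using dirichlet_fst_box[of 0 l 0 e] e by (simp add: subgraph_plateau)
    show "pointwise_variation (plateau e l) \<le> ereal (2 * e)"
      unfolding pointwise_variation_eq using list_variation_plateau[of e l] e by (intro SUP_least) auto
  qed
  finally show "F_ell V \<le> ereal V + ereal \<epsilon>" by (simp add: e_def)
qed

theorem proposition4p7:
  shows "(\<forall>\<delta>::real. \<delta> > 0 \<longrightarrow> (\<exists>V0 > 0. \<forall>V. 0 < V \<and> V < V0 \<longrightarrow>
            ereal ((1 - \<delta>) * V) \<le> F_ell V \<and> F_ell V \<le> ereal V))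
       \<and> ((\<lambda>V::real. ereal (1 / V) * F_ell V) \<longlongrightarrow> 1) (at_right 0)"
proof (rule context_conjI)
  show bounds: "\<forall>\<delta>::real. \<delta> > 0 \<longrightarrow> (\<exists>V0 > 0. \<forall>V. 0 < V \<and> V < V0 \<longrightarrow>
            ereal ((1 - \<delta>) * V) \<le> F_ell V \<and> F_ell V \<le> ereal V)"
  proof (intro allI impI)
    fix \<delta> :: real assume \<delta>: "\<delta> > 0"
    define \<epsilon> where "\<epsilon> = min 1 \<delta>"
    have \<epsilon>: "0 < \<epsilon>" "\<epsilon> \<le> 1" "\<epsilon> \<le> \<delta>" using \<delta> by (auto simp: \<epsilon>_def)
    have "\<epsilon>\<^sup>2 \<le> \<epsilon> * 1" unfolding power2_eq_square using \<epsilon> by (intro mult_left_mono) auto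
    then have le: "1 - \<delta> \<le> 1 - \<epsilon>\<^sup>2" using \<epsilon> by linarith
    have "ereal ((1 - \<delta>) * V) \<le> F_ell V \<and> F_ell V \<le> ereal V" if V: "0 < V \<and> V < \<epsilon> / 2" for V
    proof
      have "ereal ((1 - \<delta>) * V) \<le> ereal ((1 - \<epsilon>\<^sup>2) * V)" using le V by (simp add: mult_right_mono)
      also have "\<dots> \<le> F_ell V" using V by (intro F_ell_lower_bound \<epsilon>) auto
      finally show "ereal ((1 - \<delta>) * V) \<le> F_ell V" .
    qed (use V F_ell_upper_bound in auto)
    then show "\<exists>V0 > 0. \<forall>V. 0 < V \<and> V < V0 \<longrightarrow>
            ereal ((1 - \<delta>) * V) \<le> F_ell V \<and> F_ell V \<le> ereal V"
      using \<epsilon> by (intro exI[of _ "\<epsilon> / 2"]) auto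
  qed
  have ratio: "ereal (1 - \<delta>) \<le> ereal (1 / V) * F_ell V \<and> ereal (1 / V) * F_ell V \<le> 1"
    if "0 < V" "ereal ((1 - \<delta>) * V) \<le> F_ell V" "F_ell V \<le> ereal V" for \<delta> V
  proof (cases "F_ell V")
    case (real r)
    then show ?thesis using that by (simp add: field_simps one_ereal_def)
  qed (use that in auto)
  show "((\<lambda>V::real. ereal (1 / V) * F_ell V) \<longlongrightarrow> 1) (at_right 0)"
  proof (rule order_tendstoI)
    fix a :: ereal assume "a < 1"
    then obtain r where r: "a < ereal r" "ereal r < 1" using ereal_dense2 by blast
    then have "1 - r > 0" by (simp add: one_ereal_def)
    with bounds obtain V0 where V0: "V0 > 0" and
      b: "\<And>V. 0 < V \<and> V < V0 \<Longrightarrow> ereal ((1 - (1 - r)) * V) \<le> F_ell V \<and> F_ell V \<le> ereal V" by blast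
    have "\<forall>\<^sub>F V in at_right 0. V \<in> {0<..<V0}" by (rule eventually_at_rightI[OF _ V0])
    then show "\<forall>\<^sub>F V in at_right 0. a < ereal (1 / V) * F_ell V"
    proof eventually_elim
      case (elim V)
      then have "ereal (1 - (1 - r)) \<le> ereal (1 / V) * F_ell V" using ratio[of V "1 - r"] b[of V] by auto
      then show ?case using r(1) by (auto intro: less_le_trans)
    qed
  next
    fix a :: ereal assume a: "1 < a"
    obtain V0 where V0: "V0 > 0" and
      b: "\<And>V. 0 < V \<and> V < V0 \<Longrightarrow> ereal ((1 - 1) * V) \<le> F_ell V \<and> F_ell V \<le> ereal V"
      using bounds zero_less_one by blast
    have "\<forall>\<^sub>F V in at_right 0. V \<in> {0<..<V0}" by (rule eventually_at_rightI[OF _ V0])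
    then show "\<forall>\<^sub>F V in at_right 0. ereal (1 / V) * F_ell V < a"
    proof eventually_elim
      case (elim V)
      then have "ereal (1 / V) * F_ell V \<le> 1" using ratio[of V 1] b[of V] by auto
      then show ?case using a by (rule le_less_trans)
    qed
  qed
qed

end
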